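(* For every integer $n\ge 1$, $$\log^*n-\log^*\log^*n-1\;\le\; q_0(n)\;\le\;\log^*n+22.$$
   Context: Graphs are finite, simple, undirected, with non-empty vertex set. First order sentences about graphs use variables ranging over vertices, the relations $=$ and $\sim$ (adjacency), quantifiers $\forall,\exists$, connectives $\vee,\wedge,\neg$ and parentheses. A sentence $\Phi$ defines a graph $G$ if $\Phi$ is true on $G$ and false on every graph not isomorphic to $G$. The quantifier depth of a formula is the maximum number of nested quantifiers. A sentence is $0$-alternating if negations occur only directly in front of atomic formulas and no sequence of nested quantifiers contains a quantifier alternation (an occurrence of $\forall\exists$ or $\exists\forall$). $D_0(G)$ is the minimum quantifier depth of a $0$-alternating sentence defining $G$, and $q_0(n)=\min\{D_0(G): G \text{ a graph on } n \text{ vertices}\}$. $\log^*n$ is the minimum number of iterations of the binary logarithm needed to bring $n$ to $1$ or below (so $\log^* x=0$ for $x\le 1$). *)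

theory Defs
  imports Complex_Main "HOL-Library.Sublist" "Graph_Theory.Graph_Theory"
begin

text \<open>
  Vertices are natural numbers. Since every finite graph is isomorphic to one whose vertex set is
  a set of naturals, quantifying over these graphs amounts to quantifying over all finite graphs.
\<close>

definition simple_graph :: "nat pair_pre_digraph \<Rightarrow> bool" where
  "simple_graph G \<longleftrightarrow> pair_graph G \<and> pverts G \<noteq> {}"

datatype fo_formula =
    Eq nat nat
  | Adj nat nat
  | Neg fo_formula
  | Conj fo_formula fo_formula
  | Disj fo_formula fo_formula
  | ExQ nat fo_formula
  | AllQ nat fo_formula

primrec free_vars :: "fo_formula \<Rightarrow> nat set" where
  "free_vars (Eq x y) = {x, y}"
| "free_vars (Adj x y) = {x, y}"
| "free_vars (Neg \<phi>) = free_vars \<phi>"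
| "free_vars (Conj \<phi> \<psi>) = free_vars \<phi> \<union> free_vars \<psi>"
| "free_vars (Disj \<phi> \<psi>) = free_vars \<phi> \<union> free_vars \<psi>"
| "free_vars (ExQ x \<phi>) = free_vars \<phi> - {x}"
| "free_vars (AllQ x \<phi>) = free_vars \<phi> - {x}"

definition sentence :: "fo_formula \<Rightarrow> bool" where
  "sentence \<phi> \<longleftrightarrow> free_vars \<phi> = {}"

primrec sat :: "nat pair_pre_digraph \<Rightarrow> (nat \<Rightarrow> nat) \<Rightarrow> fo_formula \<Rightarrow> bool" where
  "sat G e (Eq x y) \<longleftrightarrow> e x = e y"
| "sat G e (Adj x y) \<longleftrightarrow> (e x, e y) \<in> parcs G"
| "sat G e (Neg \<phi>) \<longleftrightarrow> \<not> sat G e \<phi>"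
| "sat G e (Conj \<phi> \<psi>) \<longleftrightarrow> sat G e \<phi> \<and> sat G e \<psi>"
| "sat G e (Disj \<phi> \<psi>) \<longleftrightarrow> sat G e \<phi> \<or> sat G e \<psi>"
| "sat G e (ExQ x \<phi>) \<longleftrightarrow> (\<exists>v\<in>pverts G. sat G (e(x := v)) \<phi>)"
| "sat G e (AllQ x \<phi>) \<longleftrightarrow> (\<forall>v\<in>pverts G. sat G (e(x := v)) \<phi>)"

text \<open>For sentences the choice of the assignment is immaterial.\<close>

definition models :: "nat pair_pre_digraph \<Rightarrow> fo_formula \<Rightarrow> bool" where
  "models G \<phi> \<longleftrightarrow> (\<forall>e. range e \<subseteq> pverts G \<longrightarrow> sat G e \<phi>)"

lemma sat_cong:
  "(\<And>x. x \<in> free_vars \<phi> \<Longrightarrow> e x = e' x) \<Longrightarrow> sat G e \<phi> \<longleftrightarrow> sat G e' \<phi>"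
proof (induction \<phi> arbitrary: e e')
  case (Neg \<phi>)
  have "sat G e \<phi> = sat G e' \<phi>" by (rule Neg.IH) (use Neg.prems in auto)
  then show ?case by simp
next
  case (Conj \<phi> \<psi>)
  have "sat G e \<phi> = sat G e' \<phi>" by (rule Conj.IH(1)) (use Conj.prems in auto)
  moreover have "sat G e \<psi> = sat G e' \<psi>" by (rule Conj.IH(2)) (use Conj.prems in auto)
  ultimately show ?case by simp
next
  case (Disj \<phi> \<psi>)
  have "sat G e \<phi> = sat G e' \<phi>" by (rule Disj.IH(1)) (use Disj.prems in auto)
  moreover have "sat G e \<psi> = sat G e' \<psi>" by (rule Disj.IH(2)) (use Disj.prems in auto)
  ultimately show ?case by simp
next
  case (ExQ x \<phi>)
  have "sat G (e(x := v)) \<phi> = sat G (e'(x := v)) \<phi>" for v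
    by (rule ExQ.IH) (use ExQ.prems in auto)
  then show ?case by simp
next
  case (AllQ x \<phi>)
  have "sat G (e(x := v)) \<phi> = sat G (e'(x := v)) \<phi>" for v
    by (rule AllQ.IH) (use AllQ.prems in auto)
  then show ?case by simp
qed auto

lemma models_iff_sat:
  assumes "sentence \<phi>" "pverts G \<noteq> {}"
  shows "models G \<phi> \<longleftrightarrow> sat G e \<phi>"
proof -
  obtain v where "v \<in> pverts G" using assms by auto
  then have "range (\<lambda>_::nat. v) \<subseteq> pverts G" by auto
  moreover have "sat G e' \<phi> = sat G e \<phi>" for e'
    using assms(1) by (intro sat_cong) (simp add: sentence_def)
  ultimately show ?thesis unfolding models_def by blast
qed

definition defines_graph :: "fo_formula \<Rightarrow> nat pair_pre_digraph \<Rightarrow> bool" where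
  "defines_graph \<phi> G \<longleftrightarrow> models G \<phi> \<and>
    (\<forall>H. simple_graph H \<and> \<not> digraph_iso (with_proj H) (with_proj G) \<longrightarrow> \<not> models H \<phi>)"

primrec quantifier_depth :: "fo_formula \<Rightarrow> nat" where
  "quantifier_depth (Eq x y) = 0"
| "quantifier_depth (Adj x y) = 0"
| "quantifier_depth (Neg \<phi>) = quantifier_depth \<phi>"
| "quantifier_depth (Conj \<phi> \<psi>) = max (quantifier_depth \<phi>) (quantifier_depth \<psi>)"
| "quantifier_depth (Disj \<phi> \<psi>) = max (quantifier_depth \<phi>) (quantifier_depth \<psi>)"
| "quantifier_depth (ExQ x \<phi>) = Suc (quantifier_depth \<phi>)"
| "quantifier_depth (AllQ x \<phi>) = Suc (quantifier_depth \<phi>)"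

primrec neg_only_atoms :: "fo_formula \<Rightarrow> bool" where
  "neg_only_atoms (Eq x y) \<longleftrightarrow> True"
| "neg_only_atoms (Adj x y) \<longleftrightarrow> True"
| "neg_only_atoms (Neg \<phi>) \<longleftrightarrow> (\<exists>x y. \<phi> = Eq x y \<or> \<phi> = Adj x y)"
| "neg_only_atoms (Conj \<phi> \<psi>) \<longleftrightarrow> neg_only_atoms \<phi> \<and> neg_only_atoms \<psi>"
| "neg_only_atoms (Disj \<phi> \<psi>) \<longleftrightarrow> neg_only_atoms \<phi> \<and> neg_only_atoms \<psi>"
| "neg_only_atoms (ExQ x \<phi>) \<longleftrightarrow> neg_only_atoms \<phi>"
| "neg_only_atoms (AllQ x \<phi>) \<longleftrightarrow> neg_only_atoms \<phi>"

datatype quantifier = Exists | Forall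

text \<open>
  The maximal sequences of nested quantifiers: those met on the paths from the root of the syntax
  tree to its leaves.
\<close>

primrec quantifier_seqs :: "fo_formula \<Rightarrow> quantifier list set" where
  "quantifier_seqs (Eq x y) = {[]}"
| "quantifier_seqs (Adj x y) = {[]}"
| "quantifier_seqs (Neg \<phi>) = quantifier_seqs \<phi>"
| "quantifier_seqs (Conj \<phi> \<psi>) = quantifier_seqs \<phi> \<union> quantifier_seqs \<psi>"
| "quantifier_seqs (Disj \<phi> \<psi>) = quantifier_seqs \<phi> \<union> quantifier_seqs \<psi>"
| "quantifier_seqs (ExQ x \<phi>) = (#) Exists ` quantifier_seqs \<phi>"
| "quantifier_seqs (AllQ x \<phi>) = (#) Forall ` quantifier_seqs \<phi>"

definition zero_alternating :: "fo_formula \<Rightarrow> bool" where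
  "zero_alternating \<phi> \<longleftrightarrow> neg_only_atoms \<phi> \<and>
    (\<forall>s\<in>quantifier_seqs \<phi>. \<not> sublist [Forall, Exists] s \<and> \<not> sublist [Exists, Forall] s)"

text \<open>
  Every graph is defined by a zero-alternating sentence, namely the conjunction of an existential
  sentence listing its vertices and adjacencies and a universal one bounding the number of
  vertices. Hence the minima below are taken over non-empty sets (for the second one, if
  \<open>n \<ge> 1\<close>).
\<close>

definition D0 :: "nat pair_pre_digraph \<Rightarrow> nat" where
  "D0 G = (LEAST d. \<exists>\<phi>. sentence \<phi> \<and> zero_alternating \<phi> \<and> defines_graph \<phi> G \<and>
    quantifier_depth \<phi> = d)"

definition q0 :: "nat \<Rightarrow> nat" where
  "q0 n = (LEAST d. \<exists>G. simple_graph G \<and> card (pverts G) = n \<and> D0 G = d)"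

definition log_star :: "real \<Rightarrow> nat" where
  "log_star x = (LEAST k. (log 2 ^^ k) x \<le> 1)"

lemma log_star_le_1: "x \<le> 1 \<Longrightarrow> log_star x = 0"
  unfolding log_star_def by (rule Least_equality) auto

end

theory Submission
  imports Defs "HOL-Library.Nat_Bijection" "HOL-Library.FSet"
begin

text \<open>
  Upper bound. Suppose that every vertex \<open>w\<close> of \<open>G\<close> is the only one satisfying an existential
  formula \<open>\<tau>\<^sub>w\<close> of depth \<open>t\<close>. Then \<open>G\<close> is defined with depth \<open>t + 3\<close>: existential sentences say that
  each \<open>\<tau>\<^sub>w\<close> is realised, universal ones that realisations of \<open>\<tau>\<^sub>w\<close> and \<open>\<tau>\<^sub>w\<^sub>'\<close> are equal or
  adjacent exactly as \<open>w\<close> and \<open>w'\<close> are, and that no vertex differs from a realisation of every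
  \<open>\<tau>\<^sub>w\<close>.
  If all vertices of \<open>S\<close> are so identified, then one more quantifier identifies every vertex whose
  adjacencies to \<open>S\<close> are shared by no other vertex outside \<open>S\<close>, since non-adjacency to an
  identified vertex is an existential condition as well. Hence a rigid gadget, recognised by its
  triangles, followed by layers, each consisting of the non-empty subsets of the preceding one, has
  its size exponentiated at the price of one quantifier.

  Lower bound. A sentence of depth \<open>d\<close> without alternation that holds in \<open>G\<close> also holds in the
  subgraph induced by a set of witnesses which contains, for each chosen tuple and each type of a
  one-vertex extension, one extension of that type: universal parts are inherited by induced
  subgraphs, existential ones are witnessed. If the sentence defines \<open>G\<close>, then there are as many
  witnesses as vertices, so the number of types bounds the order of \<open>G\<close> by a tower.
\<close>

section \<open>Graphs\<close>

lemma simple_graph_iff: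
  "simple_graph G \<longleftrightarrow> finite (pverts G) \<and> pverts G \<noteq> {} \<and> parcs G \<subseteq> pverts G \<times> pverts G \<and>
    sym (parcs G) \<and> irrefl (parcs G)" (is "_ \<longleftrightarrow> ?R")
proof
  assume "simple_graph G"
  then interpret pair_graph G by (simp add: simple_graph_def)
  have "symmetric (with_proj G)" by (rule pair_sym_arcs)
  then show ?R
    using \<open>simple_graph G\<close> pair_finite_verts in_arcsD1 in_arcsD2 pair_no_loops
    by (fastforce simp: simple_graph_def symmetric_def irrefl_def)
next
  assume R: ?R
  then have "finite (parcs G)" by (meson finite_SigmaI finite_subset)
  with R show "simple_graph G"
    unfolding simple_graph_def
    by (intro conjI; unfold_locales) (auto simp: symmetric_def irrefl_def)
qed

lemma digraph_iso_of_bij_betw: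
  assumes "simple_graph G" "simple_graph H" and bij: "bij_betw h (pverts G) (pverts H)"
    and adj: "\<And>u v. u \<in> pverts G \<Longrightarrow> v \<in> pverts G \<Longrightarrow> (h u, h v) \<in> parcs H \<longleftrightarrow> (u, v) \<in> parcs G"
  shows "digraph_iso (with_proj H) (with_proj G)"
proof -
  interpret pair_graph H using assms(2) by (simp add: simple_graph_def)
  have arcs: "parcs G \<subseteq> pverts G \<times> pverts G" "parcs H \<subseteq> pverts H \<times> pverts H"
    using assms(1,2) by (auto simp: simple_graph_iff)
  define g where "g = the_inv_into (pverts G) h"
  have g: "bij_betw g (pverts H) (pverts G)"
    using bij by (simp add: g_def bij_betw_the_inv_into)
  have gh: "g (h u) = u" if "u \<in> pverts G" for u
    using bij that by (simp add: g_def the_inv_into_f_f bij_betw_def)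
  have hg: "h (g v) = v" "g v \<in> pverts G" if "v \<in> pverts H" for v
    using bij g that by (auto simp: g_def f_the_inv_into_f_bij_betw bij_betwE)
  define f :: "(nat, nat \<times> nat, nat, nat \<times> nat) digraph_isomorphism" where
    "f = \<lparr> iso_verts = g, iso_arcs = map_prod g g, iso_head = snd, iso_tail = fst \<rparr>"
  have "inj_on (map_prod g g) (parcs H)"
    using g arcs(2) by (auto simp: bij_betw_def inj_on_def subset_iff)
  then have "pre_digraph.digraph_isomorphism (with_proj H) f"
    using g wf_digraph_axioms
    by (auto simp: pre_digraph.digraph_isomorphism_def f_def bij_betw_def)
  moreover have "parcs G = map_prod g g ` parcs H"
  proof (intro equalityI subrelI)
    fix u v assume uv: "(u, v) \<in> parcs G"
    then have "u \<in> pverts G" "v \<in> pverts G" using arcs(1) by auto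
    then show "(u, v) \<in> map_prod g g ` parcs H"
      using adj uv gh by (intro image_eqI[of _ _ "(h u, h v)"]) auto
  next
    fix u v assume "(u, v) \<in> map_prod g g ` parcs H"
    then obtain x y where xy: "(x, y) \<in> parcs H" "u = g x" "v = g y" by auto
    then have "x \<in> pverts H" "y \<in> pverts H" using arcs(2) by auto
    then show "(u, v) \<in> parcs G" using xy adj[of "g x" "g y"] hg by simp
  qed
  then have "with_proj G = app_iso f (with_proj H)"
    using g by (simp add: app_iso_def f_def with_proj_def bij_betw_def)
  ultimately show ?thesis unfolding digraph_iso_def by blast
qed

lemma card_pverts_digraph_iso:
  assumes "digraph_iso (with_proj H) (with_proj G)"
  shows "card (pverts G) = card (pverts H)"
proof -
  obtain f where f: "pre_digraph.digraph_isomorphism (with_proj H) f"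
    "with_proj G = app_iso f (with_proj H)"
    using assms by (auto simp: digraph_iso_def)
  have "pverts G = iso_verts f ` pverts H"
    using arg_cong[OF f(2), of verts] by simp
  moreover have "inj_on (iso_verts f) (pverts H)"
    using pre_digraph.digraph_isomorphism_inj_on_verts[OF f(1)] by simp
  ultimately show ?thesis by (simp add: card_image)
qed

section \<open>Formulas without quantifier alternation\<close>

lemma quantifier_seqs_nonempty: "quantifier_seqs \<phi> \<noteq> {}"
  by (induction \<phi>) auto

definition only_quantifier :: "quantifier \<Rightarrow> fo_formula \<Rightarrow> bool" where
  "only_quantifier q \<phi> \<longleftrightarrow> neg_only_atoms \<phi> \<and> (\<forall>s\<in>quantifier_seqs \<phi>. set s \<subseteq> {q})"

abbreviation existential :: "fo_formula \<Rightarrow> bool" where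
  "existential \<equiv> only_quantifier Exists"

lemma only_quantifier_simps [simp]:
  "only_quantifier q (Eq x y)"
  "only_quantifier q (Adj x y)"
  "only_quantifier q (Neg \<phi>) \<longleftrightarrow> (\<exists>x y. \<phi> = Eq x y \<or> \<phi> = Adj x y)"
  "only_quantifier q (Conj \<phi> \<psi>) \<longleftrightarrow> only_quantifier q \<phi> \<and> only_quantifier q \<psi>"
  "only_quantifier q (Disj \<phi> \<psi>) \<longleftrightarrow> only_quantifier q \<phi> \<and> only_quantifier q \<psi>"
  "only_quantifier q (ExQ x \<phi>) \<longleftrightarrow> q = Exists \<and> only_quantifier q \<phi>"
  "only_quantifier q (AllQ x \<phi>) \<longleftrightarrow> q = Forall \<and> only_quantifier q \<phi>"
  using quantifier_seqs_nonempty[of \<phi>] by (auto simp: only_quantifier_def)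

lemma sublist_pair_imp_eq_iff:
  "(\<forall>a b. sublist [a, b] s \<longrightarrow> a = b) \<longleftrightarrow> (\<exists>c. set s \<subseteq> {c})"
proof (induction s)
  case (Cons x s)
  have "(\<forall>a b. sublist [a, b] (x # s) \<longrightarrow> a = b) \<longleftrightarrow>
      (\<forall>b. prefix [b] s \<longrightarrow> x = b) \<and> (\<exists>c. set s \<subseteq> {c})"
    unfolding Cons.IH[symmetric] sublist_Cons_right prefix_Cons by auto
  also have "\<dots> \<longleftrightarrow> (\<exists>c. set (x # s) \<subseteq> {c})"
    by (cases s) (auto simp: prefix_Cons)
  finally show ?case .
qed simp

lemma zero_alternating_iff:
  "zero_alternating \<phi> \<longleftrightarrow> neg_only_atoms \<phi> \<and> (\<forall>s\<in>quantifier_seqs \<phi>. \<exists>q. set s \<subseteq> {q})"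
proof -
  have "\<not> sublist [Forall, Exists] s \<and> \<not> sublist [Exists, Forall] s \<longleftrightarrow>
      (\<forall>a b. sublist [a, b] s \<longrightarrow> a = b)" for s
    by (metis quantifier.distinct(1) quantifier.exhaust)
  then show ?thesis by (simp add: zero_alternating_def sublist_pair_imp_eq_iff)
qed

lemma zero_alternating_simps [simp]:
  "zero_alternating (Conj \<phi> \<psi>) \<longleftrightarrow> zero_alternating \<phi> \<and> zero_alternating \<psi>"
  "zero_alternating (Disj \<phi> \<psi>) \<longleftrightarrow> zero_alternating \<phi> \<and> zero_alternating \<psi>"
  "zero_alternating (ExQ x \<phi>) \<longleftrightarrow> only_quantifier Exists \<phi>"
  "zero_alternating (AllQ x \<phi>) \<longleftrightarrow> only_quantifier Forall \<phi>"
  by (auto simp: zero_alternating_iff only_quantifier_def)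

lemma only_quantifier_imp_zero_alternating: "only_quantifier q \<phi> \<Longrightarrow> zero_alternating \<phi>"
  by (auto simp: zero_alternating_iff only_quantifier_def)

primrec dual :: "fo_formula \<Rightarrow> fo_formula" where
  "dual (Eq x y) = Neg (Eq x y)"
| "dual (Adj x y) = Neg (Adj x y)"
| "dual (Neg \<phi>) = \<phi>"
| "dual (Conj \<phi> \<psi>) = Disj (dual \<phi>) (dual \<psi>)"
| "dual (Disj \<phi> \<psi>) = Conj (dual \<phi>) (dual \<psi>)"
| "dual (ExQ x \<phi>) = AllQ x (dual \<phi>)"
| "dual (AllQ x \<phi>) = ExQ x (dual \<phi>)"

lemma sat_dual [simp]: "sat G e (dual \<phi>) \<longleftrightarrow> \<not> sat G e \<phi>"
  by (induction \<phi> arbitrary: e) auto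

lemma free_vars_dual [simp]: "free_vars (dual \<phi>) = free_vars \<phi>"
  by (induction \<phi>) auto

lemma quantifier_depth_dual [simp]: "quantifier_depth (dual \<phi>) = quantifier_depth \<phi>"
  by (induction \<phi>) auto

lemma only_quantifier_dual: "only_quantifier q \<phi> \<Longrightarrow> q \<noteq> q' \<Longrightarrow> only_quantifier q' (dual \<phi>)"
  by (cases q; cases q'; induction \<phi>; auto)

text \<open>No sentence is quantifier-free; hence the conjunct \<open>\<phi>\<close> in place of a constant for truth.\<close>

definition conj_set :: "fo_formula \<Rightarrow> fo_formula set \<Rightarrow> fo_formula" where
  "conj_set \<phi> \<Phi> = foldr Conj (SOME \<phi>s. set \<phi>s = \<Phi>) \<phi>"

lemma conj_set_eq_foldr: "finite \<Phi> \<Longrightarrow> \<exists>\<phi>s. set \<phi>s = \<Phi> \<and> conj_set \<phi> \<Phi> = foldr Conj \<phi>s \<phi>"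
  unfolding conj_set_def using someI_ex[OF finite_list] by blast

lemma foldr_Conj_simps:
  "sat G e (foldr Conj \<phi>s \<phi>) \<longleftrightarrow> sat G e \<phi> \<and> (\<forall>\<psi>\<in>set \<phi>s. sat G e \<psi>)"
  "free_vars (foldr Conj \<phi>s \<phi>) = free_vars \<phi> \<union> \<Union> (free_vars ` set \<phi>s)"
  "only_quantifier q (foldr Conj \<phi>s \<phi>) \<longleftrightarrow> only_quantifier q \<phi> \<and> (\<forall>\<psi>\<in>set \<phi>s. only_quantifier q \<psi>)"
  "zero_alternating (foldr Conj \<phi>s \<phi>) \<longleftrightarrow> zero_alternating \<phi> \<and> (\<forall>\<psi>\<in>set \<phi>s. zero_alternating \<psi>)"
  "quantifier_depth (foldr Conj \<phi>s \<phi>) \<le> d \<longleftrightarrow>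
    quantifier_depth \<phi> \<le> d \<and> (\<forall>\<psi>\<in>set \<phi>s. quantifier_depth \<psi> \<le> d)"
  by (induction \<phi>s) auto

lemma conj_set_simps [simp]:
  assumes "finite \<Phi>"
  shows "sat G e (conj_set \<phi> \<Phi>) \<longleftrightarrow> sat G e \<phi> \<and> (\<forall>\<psi>\<in>\<Phi>. sat G e \<psi>)"
    and "free_vars (conj_set \<phi> \<Phi>) = free_vars \<phi> \<union> \<Union> (free_vars ` \<Phi>)"
    and "only_quantifier q (conj_set \<phi> \<Phi>) \<longleftrightarrow> only_quantifier q \<phi> \<and> (\<forall>\<psi>\<in>\<Phi>. only_quantifier q \<psi>)"
    and "zero_alternating (conj_set \<phi> \<Phi>) \<longleftrightarrow> zero_alternating \<phi> \<and> (\<forall>\<psi>\<in>\<Phi>. zero_alternating \<psi>)"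
    and "quantifier_depth (conj_set \<phi> \<Phi>) \<le> d \<longleftrightarrow>
      quantifier_depth \<phi> \<le> d \<and> (\<forall>\<psi>\<in>\<Phi>. quantifier_depth \<psi> \<le> d)"
  using conj_set_eq_foldr[OF assms, of \<phi>] by (auto simp: foldr_Conj_simps)

definition lit :: "bool \<Rightarrow> fo_formula \<Rightarrow> fo_formula" where
  "lit b \<phi> = (if b then \<phi> else Neg \<phi>)"

lemma lit_simps [simp]:
  "sat G e (lit b \<phi>) \<longleftrightarrow> (sat G e \<phi> \<longleftrightarrow> b)"
  "free_vars (lit b \<phi>) = free_vars \<phi>"
  "quantifier_depth (lit b \<phi>) = quantifier_depth \<phi>"
  "only_quantifier q (lit b (Eq x y))"
  "only_quantifier q (lit b (Adj x y))"
  by (auto simp: lit_def)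

primrec ex_block :: "nat \<Rightarrow> fo_formula \<Rightarrow> fo_formula" where
  "ex_block 0 \<phi> = \<phi>"
| "ex_block (Suc m) \<phi> = ex_block m (ExQ m \<phi>)"

lemma sat_ex_block:
  "sat G e (ex_block m \<phi>) \<longleftrightarrow>
    (\<exists>f. f ` {..<m} \<subseteq> pverts G \<and> sat G (override_on e f {..<m}) \<phi>)"
proof (induction m arbitrary: \<phi>)
  case (Suc m)
  have upd: "(override_on e f {..<m})(m := v) = override_on e (f(m := v)) {..<Suc m}" for f v
    by (auto simp: fun_eq_iff override_on_def less_Suc_eq)
  have "sat G e (ex_block (Suc m) \<phi>) \<longleftrightarrow> (\<exists>f. f ` {..<m} \<subseteq> pverts G \<and>
      (\<exists>v\<in>pverts G. sat G (override_on e (f(m := v)) {..<Suc m}) \<phi>))"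
    by (simp add: Suc.IH upd)
  also have "\<dots> \<longleftrightarrow>
      (\<exists>f. f ` {..<Suc m} \<subseteq> pverts G \<and> sat G (override_on e f {..<Suc m}) \<phi>)" (is "?L \<longleftrightarrow> ?R")
  proof
    assume ?L
    then obtain f v where "f ` {..<m} \<subseteq> pverts G" "v \<in> pverts G"
      "sat G (override_on e (f(m := v)) {..<Suc m}) \<phi>" by blast
    then show ?R by (intro exI[of _ "f(m := v)"]) (auto simp: lessThan_Suc)
  next
    assume ?R
    then obtain f where "f ` {..<Suc m} \<subseteq> pverts G"
      "sat G (override_on e (f(m := f m)) {..<Suc m}) \<phi>"
      by auto
    then show ?L by (intro exI[of _ f] conjI bexI[of _ "f m"]) auto
  qed
  finally show ?case .
qed simp

lemma ex_block_simps [simp]: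
  "free_vars (ex_block m \<phi>) = free_vars \<phi> - {..<m}"
  "existential (ex_block m \<phi>) \<longleftrightarrow> existential \<phi>"
  "quantifier_depth (ex_block m \<phi>) = m + quantifier_depth \<phi>"
  by (induction m arbitrary: \<phi>) auto

definition distinct_vars :: "nat \<Rightarrow> fo_formula" where
  "distinct_vars m = conj_set (Eq 0 0) ((\<lambda>(i, j). lit (i = j) (Eq i j)) ` ({..<m} \<times> {..<m}))"

definition diagram :: "nat \<Rightarrow> (nat \<Rightarrow> nat \<Rightarrow> bool) \<Rightarrow> fo_formula" where
  "diagram m R = conj_set (distinct_vars m) ((\<lambda>(i, j). lit (R i j) (Adj i j)) ` ({..<m} \<times> {..<m}))"

lemma sat_distinct_vars [simp]: "sat G e (distinct_vars m) \<longleftrightarrow> inj_on e {..<m}"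
  by (auto simp: distinct_vars_def inj_on_def)

lemma sat_diagram [simp]:
  "sat G e (diagram m R) \<longleftrightarrow>
    inj_on e {..<m} \<and> (\<forall>i<m. \<forall>j<m. (e i, e j) \<in> parcs G \<longleftrightarrow> R i j)"
  by (auto simp: diagram_def)

lemma free_vars_diagram:
  assumes "0 < m"
  shows "free_vars (distinct_vars m) = {..<m}" "free_vars (diagram m R) = {..<m}"
  using assms by (auto simp: distinct_vars_def diagram_def)

lemma only_quantifier_diagram [simp]:
  "only_quantifier q (distinct_vars m)" "only_quantifier q (diagram m R)"
  by (auto simp: distinct_vars_def diagram_def)

lemma quantifier_depth_diagram [simp]:
  "quantifier_depth (distinct_vars m) = 0" "quantifier_depth (diagram m R) = 0"
proof -
  have "quantifier_depth (distinct_vars m) \<le> 0"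
    unfolding distinct_vars_def by (subst conj_set_simps) auto
  moreover from this have "quantifier_depth (diagram m R) \<le> 0"
    unfolding diagram_def by (subst conj_set_simps) auto
  ultimately show "quantifier_depth (distinct_vars m) = 0" "quantifier_depth (diagram m R) = 0"
    by simp_all
qed

lemma inj_on_override_on [simp]: "inj_on (override_on e f A) A \<longleftrightarrow> inj_on f A"
  by (simp add: inj_on_def)

definition embedding ::
    "nat \<Rightarrow> (nat \<Rightarrow> nat \<Rightarrow> bool) \<Rightarrow> (nat \<Rightarrow> nat) \<Rightarrow> nat pair_pre_digraph \<Rightarrow> bool" where
  "embedding m R f G \<longleftrightarrow> f ` {..<m} \<subseteq> pverts G \<and> inj_on f {..<m} \<and>
    (\<forall>i<m. \<forall>j<m. (f i, f j) \<in> parcs G \<longleftrightarrow> R i j)"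

lemma bij_betw_embedding:
  assumes "embedding m R f G" "simple_graph G" "card (pverts G) \<le> m"
  shows "bij_betw f {..<m} (pverts G)"
proof -
  have "f ` {..<m} = pverts G"
    using assms by (intro card_seteq) (auto simp: embedding_def simple_graph_iff card_image)
  then show ?thesis using assms(1) by (simp add: embedding_def bij_betw_def)
qed

lemma digraph_iso_of_embeddings:
  assumes "simple_graph G" "simple_graph H" "card (pverts G) \<le> m" "card (pverts H) \<le> m"
    and f: "embedding m R f G" and h: "embedding m R h H"
  shows "digraph_iso (with_proj H) (with_proj G)"
proof (rule digraph_iso_of_bij_betw[OF assms(1,2)])
  let ?f' = "the_inv_into {..<m} f"
  have bij: "bij_betw f {..<m} (pverts G)" using f assms(1,3) by (rule bij_betw_embedding)
  show "bij_betw (h \<circ> ?f') (pverts G) (pverts H)"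
    by (rule bij_betw_trans[OF bij_betw_the_inv_into[OF bij] bij_betw_embedding[OF h assms(2,4)]])
  show "((h \<circ> ?f') u, (h \<circ> ?f') v) \<in> parcs H \<longleftrightarrow> (u, v) \<in> parcs G"
    if "u \<in> pverts G" "v \<in> pverts G" for u v
  proof -
    have "u \<in> f ` {..<m}" "v \<in> f ` {..<m}" using bij that by (simp_all add: bij_betw_def)
    then obtain i j where "u = f i" "v = f j" "i < m" "j < m" by auto
    then show ?thesis using f h by (simp add: embedding_def the_inv_into_f_f)
  qed
qed

lemma sat_ex_diagram: "sat G e (ex_block m (diagram m R)) \<longleftrightarrow> (\<exists>f. embedding m R f G)"
  by (simp add: sat_ex_block embedding_def)

lemma sat_ex_distinct_vars:
  assumes "finite (pverts G)"
  shows "sat G e (ex_block m (distinct_vars m)) \<longleftrightarrow> m \<le> card (pverts G)"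
  using inj_on_iff_card_le[OF _ assms, of "{..<m}"] by (auto simp: sat_ex_block)

section \<open>Definability\<close>

definition definable0 :: "nat \<Rightarrow> nat pair_pre_digraph \<Rightarrow> bool" where
  "definable0 d G \<longleftrightarrow> (\<exists>\<phi>. sentence \<phi> \<and> zero_alternating \<phi> \<and> defines_graph \<phi> G \<and>
    quantifier_depth \<phi> \<le> d)"

lemma D0_le: "definable0 d G \<Longrightarrow> D0 G \<le> d"
  unfolding definable0_def D0_def by (elim exE conjE, rule le_trans, rule Least_le) auto

lemma definable0_D0: "definable0 d G \<Longrightarrow> definable0 (D0 G) G"
  unfolding definable0_def D0_def by (rule LeastI2_ex) auto

lemma definable0I:
  assumes G: "pverts G \<noteq> {}" and d: "1 \<le> d" and fin: "finite P" "finite N"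
    and ex: "\<And>\<phi>. \<phi> \<in> P \<union> N \<Longrightarrow> existential \<phi> \<and> free_vars \<phi> = {} \<and> quantifier_depth \<phi> \<le> d"
    and sat: "\<And>\<phi>. \<phi> \<in> P \<Longrightarrow> sat G e \<phi>" "\<And>\<phi>. \<phi> \<in> N \<Longrightarrow> \<not> sat G e \<phi>"
    and iso: "\<And>H. simple_graph H \<Longrightarrow> (\<And>\<phi>. \<phi> \<in> P \<Longrightarrow> sat H e \<phi>) \<Longrightarrow>
      (\<And>\<phi>. \<phi> \<in> N \<Longrightarrow> \<not> sat H e \<phi>) \<Longrightarrow> digraph_iso (with_proj H) (with_proj G)"
  shows "definable0 d G"
proof -
  define \<Phi> where "\<Phi> = conj_set (ExQ 0 (Eq 0 0)) (P \<union> dual ` N)"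
  have sentence: "sentence \<Phi>" using ex fin by (auto simp: sentence_def \<Phi>_def)
  have "zero_alternating (dual \<phi>)" if "\<phi> \<in> N" for \<phi>
    using ex that only_quantifier_dual[of Exists \<phi> Forall]
    by (auto intro: only_quantifier_imp_zero_alternating)
  then have alternation: "zero_alternating \<Phi>"
    using ex fin by (auto simp: \<Phi>_def intro: only_quantifier_imp_zero_alternating)
  have depth: "quantifier_depth \<Phi> \<le> d" using ex d fin by (auto simp: \<Phi>_def)
  have models: "models H \<Phi> \<longleftrightarrow> (\<forall>\<phi>\<in>P. sat H e \<phi>) \<and> (\<forall>\<phi>\<in>N. \<not> sat H e \<phi>)"
    if "pverts H \<noteq> {}" for H
    unfolding models_iff_sat[OF sentence that, of e] using fin that by (auto simp: \<Phi>_def ball_Un)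
  have "defines_graph \<Phi> G"
    unfolding defines_graph_def
  proof (intro conjI allI impI notI; (elim conjE)?)
    show "models G \<Phi>" using sat by (simp add: models[OF G])
  next
    fix H assume "simple_graph H" "models H \<Phi>" "\<not> digraph_iso (with_proj H) (with_proj G)"
    then show False using iso models by (auto simp: simple_graph_iff)
  qed
  then show ?thesis using sentence alternation depth by (auto simp: definable0_def)
qed

lemma definable0_Suc_card:
  assumes G: "simple_graph G"
  shows "definable0 (Suc (card (pverts G))) G"
proof -
  define n where "n = card (pverts G)"
  have fin: "finite (pverts G)" and ne: "pverts G \<noteq> {}" using G by (auto simp: simple_graph_iff)
  then have "0 < n" by (simp add: n_def card_gt_0_iff)
  obtain g where "bij_betw g {..<n} (pverts G)"
    using ex_bij_betw_nat_finite[OF fin] by (auto simp: n_def atLeast0LessThan)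
  then have g: "embedding n (\<lambda>i j. (g i, g j) \<in> parcs G) g G"
    by (simp add: embedding_def bij_betw_def)
  let ?embeds = "ex_block n (diagram n (\<lambda>i j. (g i, g j) \<in> parcs G))"
  let ?larger = "ex_block (Suc n) (distinct_vars (Suc n))"
  show ?thesis
  proof (rule definable0I[where P = "{?embeds}" and N = "{?larger}" and e = "\<lambda>_. 0"])
    show "existential \<phi> \<and> free_vars \<phi> = {} \<and> quantifier_depth \<phi> \<le> Suc (card (pverts G))"
      if "\<phi> \<in> {?embeds} \<union> {?larger}" for \<phi>
      using that \<open>0 < n\<close> by (auto simp: free_vars_diagram n_def)
    show "sat G (\<lambda>_. 0) \<phi>" if "\<phi> \<in> {?embeds}" for \<phi>
      using that g sat_ex_diagram by blast
    show "\<not> sat G (\<lambda>_. 0) \<phi>" if "\<phi> \<in> {?larger}" for \<phi>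
      using that sat_ex_distinct_vars[OF fin, of _ "Suc n"] by (simp add: n_def)
  next
    fix H assume H: "simple_graph H" and "\<And>\<phi>. \<phi> \<in> {?embeds} \<Longrightarrow> sat H (\<lambda>_. 0) \<phi>"
      "\<And>\<phi>. \<phi> \<in> {?larger} \<Longrightarrow> \<not> sat H (\<lambda>_. 0) \<phi>"
    moreover have "finite (pverts H)" using H by (simp add: simple_graph_iff)
    ultimately obtain f where "embedding n (\<lambda>i j. (g i, g j) \<in> parcs G) f H" "card (pverts H) \<le> n"
      using sat_ex_diagram sat_ex_distinct_vars[of H _ "Suc n"] by auto
    then show "digraph_iso (with_proj H) (with_proj G)"
      using digraph_iso_of_embeddings[OF G H _ _ g] by (simp add: n_def)
  qed (use ne in auto)
qed

lemma simple_graph_with_card: "1 \<le> n \<Longrightarrow> \<exists>G. simple_graph G \<and> card (pverts G) = n"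
  by (intro exI[of _ "\<lparr>pverts = {..<n}, parcs = {}\<rparr>"])
    (auto simp: simple_graph_iff sym_def irrefl_def lessThan_empty_iff)

lemma q0_attained:
  assumes "1 \<le> n"
  obtains G where "simple_graph G" "card (pverts G) = n" "definable0 (q0 n) G"
proof -
  have "\<exists>d G. simple_graph G \<and> card (pverts G) = n \<and> D0 G = d"
    using simple_graph_with_card[OF assms] by blast
  then have "\<exists>G. simple_graph G \<and> card (pverts G) = n \<and> D0 G = q0 n"
    unfolding q0_def by (rule LeastI_ex)
  then show thesis using that definable0_D0 definable0_Suc_card by metis
qed

lemma q0_le:
  assumes "simple_graph G" "definable0 d G"
  shows "q0 (card (pverts G)) \<le> d"
proof -
  have "q0 (card (pverts G)) \<le> D0 G" unfolding q0_def using assms(1) by (intro Least_le) blast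
  also have "D0 G \<le> d" using assms(2) by (rule D0_le)
  finally show ?thesis .
qed

lemma q0_le_Suc:
  assumes "1 \<le> n"
  shows "q0 n \<le> Suc n"
  using simple_graph_with_card[OF assms] q0_le definable0_Suc_card by blast

section \<open>Identifying vertices by existential formulas\<close>

definition realises :: "nat pair_pre_digraph \<Rightarrow> fo_formula \<Rightarrow> nat \<Rightarrow> bool" where
  "realises G \<tau> v \<longleftrightarrow> sat G (\<lambda>_. v) \<tau>"

text \<open>The free variable is \<open>t\<close> itself, so that nested identifying formulas use distinct variables.\<close>

definition identifies :: "nat pair_pre_digraph \<Rightarrow> nat \<Rightarrow> nat \<Rightarrow> fo_formula \<Rightarrow> bool" where
  "identifies G t w \<tau> \<longleftrightarrow> existential \<tau> \<and> free_vars \<tau> \<subseteq> {t} \<and> quantifier_depth \<tau> \<le> t \<and>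
    (\<forall>v\<in>pverts G. realises G \<tau> v \<longleftrightarrow> v = w)"

definition identifiable :: "nat pair_pre_digraph \<Rightarrow> nat \<Rightarrow> nat \<Rightarrow> bool" where
  "identifiable G t w \<longleftrightarrow> (\<exists>\<tau>. identifies G t w \<tau>)"

lemma sat_iff_realises: "free_vars \<tau> \<subseteq> {t} \<Longrightarrow> sat G e \<tau> \<longleftrightarrow> realises G \<tau> (e t)"
  unfolding realises_def by (rule sat_cong) auto

lemma identifiesD:
  assumes "identifies G t w \<tau>"
  shows "existential \<tau>" "free_vars \<tau> \<subseteq> {t}" "quantifier_depth \<tau> \<le> t"
    and "sat H e \<tau> \<longleftrightarrow> realises H \<tau> (e t)"
    and "v \<in> pverts G \<Longrightarrow> realises G \<tau> v \<longleftrightarrow> v = w"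
  using assms by (auto simp: identifies_def sat_iff_realises)

lemma identifiableI:
  assumes "existential \<tau>" "free_vars \<tau> \<subseteq> {t}" "quantifier_depth \<tau> \<le> t"
    and "\<And>e. e t \<in> pverts G \<Longrightarrow> sat G e \<tau> \<longleftrightarrow> e t = w"
  shows "identifiable G t w"
proof -
  have "realises G \<tau> v \<longleftrightarrow> v = w" if "v \<in> pverts G" for v
    using assms(4)[of "\<lambda>_. v"] that by (simp add: realises_def)
  then show ?thesis using assms(1-3) unfolding identifiable_def identifies_def by blast
qed

lemma identifiable_Suc:
  assumes "identifiable G t w" "w \<in> pverts G"
  shows "identifiable G (Suc t) w"
proof -
  obtain \<tau> where "identifies G t w \<tau>" using assms(1) by (auto simp: identifiable_def)
  note \<tau> = identifiesD[OF this]
  show ?thesis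
    by (rule identifiableI[of "ExQ t (Conj \<tau> (Eq (Suc t) t))"]) (use \<tau> assms(2) in auto)
qed

lemma identifiable_by_adjacency:
  assumes S: "finite S" "S \<subseteq> pverts G" "\<And>w. w \<in> S \<Longrightarrow> identifiable G t w"
    and u: "u \<in> pverts G" "u \<notin> S"
    and unique: "\<And>v. v \<in> pverts G \<Longrightarrow> v \<notin> S \<Longrightarrow>
      (\<And>w. w \<in> S \<Longrightarrow> (v, w) \<in> parcs G \<longleftrightarrow> (u, w) \<in> parcs G) \<Longrightarrow> v = u"
  shows "identifiable G (Suc t) u"
proof -
  obtain \<tau> where "\<And>w. w \<in> S \<Longrightarrow> identifies G t w (\<tau> w)"
    using S(3) unfolding identifiable_def by metis
  note \<tau> = identifiesD[OF this]
  define \<phi> where "\<phi> = conj_set (Eq (Suc t) (Suc t)) ((\<lambda>w. ExQ t (Conj (\<tau> w)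
    (Conj (Neg (Eq (Suc t) t)) (lit ((u, w) \<in> parcs G) (Adj (Suc t) t))))) ` S)"
  show ?thesis
  proof (rule identifiableI[of \<phi>])
    show "free_vars \<phi> \<subseteq> {Suc t}" using S(1) by (auto simp: \<phi>_def dest: subsetD[OF \<tau>(2)])
  next
    fix e assume e: "e (Suc t) \<in> pverts G"
    have "sat G e \<phi> \<longleftrightarrow>
        (\<forall>w\<in>S. e (Suc t) \<noteq> w \<and> ((e (Suc t), w) \<in> parcs G \<longleftrightarrow> (u, w) \<in> parcs G))"
      using S(1,2) \<tau>(4,5) by (auto simp: \<phi>_def)
    also have "\<dots> \<longleftrightarrow> e (Suc t) = u" using u unique[OF e] by blast
    finally show "sat G e \<phi> \<longleftrightarrow> e (Suc t) = u" .
  qed (use S(1) \<tau> in \<open>auto simp: \<phi>_def\<close>)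
qed

lemma identifiable_rigid:
  assumes "{..<m} \<subseteq> pverts G" "w < m"
    and rigid: "\<And>f. embedding m (\<lambda>i j. (i, j) \<in> parcs G) f G \<Longrightarrow> f w = w"
  shows "identifiable G m w"
proof (rule identifiableI)
  let ?R = "\<lambda>i j. (i, j) \<in> parcs G"
  let ?\<tau> = "ex_block m (Conj (diagram m ?R) (Eq w m))"
  show "sat G e ?\<tau> \<longleftrightarrow> e m = w" if "e m \<in> pverts G" for e
  proof -
    have "sat G e ?\<tau> \<longleftrightarrow> (\<exists>f. embedding m ?R f G \<and> f w = e m)"
      using \<open>w < m\<close> by (simp add: sat_ex_block embedding_def)
    also have "\<dots> \<longleftrightarrow> e m = w"
    proof
      have "embedding m ?R (\<lambda>i. i) G" using assms(1) by (simp add: embedding_def)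
      then show "\<exists>f. embedding m ?R f G \<and> f w = e m" if "e m = w" using that by auto
    qed (use rigid in metis)
    finally show ?thesis .
  qed
qed (use \<open>w < m\<close> in \<open>auto simp: free_vars_diagram\<close>)

locale identified_graph =
  fixes G :: "nat pair_pre_digraph" and t :: nat and \<tau> :: "nat \<Rightarrow> fo_formula"
  assumes simple: "simple_graph G"
    and identifies: "w \<in> pverts G \<Longrightarrow> identifies G t w (\<tau> w)"
begin

lemmas formula = identifiesD[OF identifies]

definition realised :: "nat \<Rightarrow> fo_formula" where
  "realised w = ExQ t (\<tau> w)"

text \<open>The inner quantifier transfers \<open>\<tau> w\<close> to the variable \<open>Suc t\<close>.\<close>

definition mismatch :: "nat \<Rightarrow> nat \<Rightarrow> fo_formula" where
  "mismatch w w' = ExQ (Suc t) (ExQ t (Conj (ExQ t (Conj (\<tau> w) (Eq (Suc t) t))) (Conj (\<tau> w')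
    (Disj (lit (w \<noteq> w') (Eq (Suc t) t)) (lit ((w, w') \<notin> parcs G) (Adj (Suc t) t))))))"

definition unidentified :: fo_formula where
  "unidentified = ExQ (Suc t) (conj_set (Eq (Suc t) (Suc t))
    ((\<lambda>w. ExQ t (Conj (\<tau> w) (Neg (Eq (Suc t) t)))) ` pverts G))"

lemma finite_pverts [simp]: "finite (pverts G)"
  using simple by (simp add: simple_graph_iff)

lemma sat_realised:
  "w \<in> pverts G \<Longrightarrow> sat H e (realised w) \<longleftrightarrow> (\<exists>v\<in>pverts H. realises H (\<tau> w) v)"
  by (simp add: realised_def formula(4))

lemma sat_mismatch:
  "w \<in> pverts G \<Longrightarrow> w' \<in> pverts G \<Longrightarrow> sat H e (mismatch w w') \<longleftrightarrow>
    (\<exists>v\<in>pverts H. \<exists>v'\<in>pverts H. realises H (\<tau> w) v \<and> realises H (\<tau> w') v' \<and>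
      ((v = v') \<noteq> (w = w') \<or> ((v, v') \<in> parcs H) \<noteq> ((w, w') \<in> parcs G)))"
  by (auto simp: mismatch_def formula(4))

lemma sat_unidentified:
  "sat H e unidentified \<longleftrightarrow>
    (\<exists>v\<in>pverts H. \<forall>w\<in>pverts G. \<exists>v'\<in>pverts H. realises H (\<tau> w) v' \<and> v \<noteq> v')"
  by (auto simp: unidentified_def formula(4))

lemma digraph_iso_of_realisation:
  assumes H: "simple_graph H"
    and realised: "\<And>w. w \<in> pverts G \<Longrightarrow> sat H e (realised w)"
    and match: "\<And>w w'. w \<in> pverts G \<Longrightarrow> w' \<in> pverts G \<Longrightarrow> \<not> sat H e (mismatch w w')"
    and identified: "\<not> sat H e unidentified"
  shows "digraph_iso (with_proj H) (with_proj G)"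
proof -
  have "\<forall>w\<in>pverts G. \<exists>v\<in>pverts H. realises H (\<tau> w) v"
    using realised sat_realised by blast
  then obtain h where h: "\<And>w. w \<in> pverts G \<Longrightarrow> h w \<in> pverts H \<and> realises H (\<tau> w) (h w)"
    by metis
  have eq_adj: "(h w = h w' \<longleftrightarrow> w = w') \<and> ((h w, h w') \<in> parcs H \<longleftrightarrow> (w, w') \<in> parcs G)"
    if "w \<in> pverts G" "w' \<in> pverts G" for w w'
    using match[OF that] h that unfolding sat_mismatch[OF that] by blast
  have "\<exists>w\<in>pverts G. v = h w" if "v \<in> pverts H" for v
    using identified h that unfolding sat_unidentified by blast
  then have "bij_betw h (pverts G) (pverts H)"
    unfolding bij_betw_def inj_on_def using eq_adj h by blast
  then show ?thesis by (rule digraph_iso_of_bij_betw[OF simple H]) (use eq_adj in blast)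
qed

lemma definable0_add_3: "definable0 (t + 3) G"
proof (rule definable0I[where e = "\<lambda>_. 0"
      and P = "realised ` pverts G"
      and N = "insert unidentified ((\<lambda>(w, w'). mismatch w w') ` (pverts G \<times> pverts G))"])
  have "existential (realised w) \<and> free_vars (realised w) = {} \<and>
      quantifier_depth (realised w) \<le> t + 3" if "w \<in> pverts G" for w
    using formula(1-3)[OF that] by (auto simp: realised_def)
  moreover have "existential (mismatch w w') \<and> free_vars (mismatch w w') = {} \<and>
      quantifier_depth (mismatch w w') \<le> t + 3" if "w \<in> pverts G" "w' \<in> pverts G" for w w'
    using formula(1-3)[OF that(1)] formula(1-3)[OF that(2)] by (auto simp: mismatch_def)
  moreover have "existential unidentified \<and> free_vars unidentified = {} \<and>
      quantifier_depth unidentified \<le> t + 3"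
  proof -
    have "quantifier_depth unidentified \<le> Suc (Suc t)"
      using formula(3) by (simp add: unidentified_def)
    moreover have "existential unidentified" using formula(1) by (simp add: unidentified_def)
    moreover have "free_vars unidentified = {}" using formula(2) by (auto simp: unidentified_def)
    ultimately show ?thesis by simp
  qed
  ultimately show "existential \<phi> \<and> free_vars \<phi> = {} \<and> quantifier_depth \<phi> \<le> t + 3"
    if "\<phi> \<in> realised ` pverts G \<union>
      insert unidentified ((\<lambda>(w, w'). mismatch w w') ` (pverts G \<times> pverts G))" for \<phi>
    using that by auto
  show "sat G (\<lambda>_. 0) \<phi>" if "\<phi> \<in> realised ` pverts G" for \<phi>
    using that formula(5) by (auto simp: sat_realised)
  show "\<not> sat G (\<lambda>_. 0) \<phi>"
    if "\<phi> \<in> insert unidentified ((\<lambda>(w, w'). mismatch w w') ` (pverts G \<times> pverts G))" for \<phi>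
    using that formula(5) by (auto simp: sat_mismatch sat_unidentified)
next
  fix H assume "simple_graph H" "\<And>\<phi>. \<phi> \<in> realised ` pverts G \<Longrightarrow> sat H (\<lambda>_. 0) \<phi>"
    "\<And>\<phi>. \<phi> \<in> insert unidentified ((\<lambda>(w, w'). mismatch w w') ` (pverts G \<times> pverts G)) \<Longrightarrow>
      \<not> sat H (\<lambda>_. 0) \<phi>"
  then show "digraph_iso (with_proj H) (with_proj G)"
    by (intro digraph_iso_of_realisation) auto
qed (use simple in \<open>auto simp: simple_graph_iff\<close>)

end

lemma definable0_identifiable:
  assumes "simple_graph G" and "\<And>w. w \<in> pverts G \<Longrightarrow> identifiable G t w"
  shows "definable0 (t + 3) G"
proof -
  obtain \<tau> where "\<And>w. w \<in> pverts G \<Longrightarrow> identifies G t w (\<tau> w)"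
    using assms(2) unfolding identifiable_def by metis
  then interpret identified_graph G t \<tau> by (unfold_locales) (use assms(1) in auto)
  show ?thesis by (rule definable0_add_3)
qed

section \<open>The layered graph\<close>

lemma set_decode_power_le: "x \<in> set_decode y \<Longrightarrow> 2 ^ x \<le> y"
  by (metis div_less even_zero not_less set_decode_def mem_Collect_eq)

lemma set_decode_less: "x \<in> set_decode y \<Longrightarrow> x < y"
  using less_exp[of x] set_decode_power_le[of x y] by linarith

text \<open>
  A vertex beyond the gadget is the Ackermann code of the set of its neighbours in the preceding
  layer. The empty set is left out: it is the set of neighbours there of every vertex beyond the
  next layer.
\<close>

primrec layer :: "nat \<Rightarrow> nat set" where
  "layer 0 = {5, 6}"
| "layer (Suc j) = set_encode ` (Pow (layer j) - {{}})"

lemma finite_layer [simp]: "finite (layer j)"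
  by (induction j) auto

lemma mem_layer_Suc_iff: "y \<in> layer (Suc j) \<longleftrightarrow> set_decode y \<subseteq> layer j \<and> set_decode y \<noteq> {}"
proof
  assume "y \<in> layer (Suc j)"
  then obtain A where "y = set_encode A" "A \<subseteq> layer j" "A \<noteq> {}" by auto
  moreover from this have "finite A" using finite_subset[OF _ finite_layer] by blast
  ultimately show "set_decode y \<subseteq> layer j \<and> set_decode y \<noteq> {}" by simp
next
  assume "set_decode y \<subseteq> layer j \<and> set_decode y \<noteq> {}"
  then have "set_encode (set_decode y) \<in> layer (Suc j)" unfolding layer.simps by blast
  then show "y \<in> layer (Suc j)" by simp
qed

lemma layer_ge: "x \<in> layer j \<Longrightarrow> 5 \<le> x"
proof (induction j arbitrary: x)
  case (Suc j)
  then show ?case using set_decode_less unfolding mem_layer_Suc_iff by fastforce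
qed auto

lemma layer_Suc_ge: "x \<in> layer (Suc j) \<Longrightarrow> 7 \<le> x"
proof -
  assume "x \<in> layer (Suc j)"
  then obtain y where y: "y \<in> set_decode x" "5 \<le> y"
    using layer_ge unfolding mem_layer_Suc_iff by blast
  have "(2::nat) ^ 5 \<le> 2 ^ y" using y(2) by (intro power_increasing) auto
  then show "7 \<le> x" using set_decode_power_le[OF y(1)] by simp
qed

lemma layer_disjoint: "x \<in> layer i \<Longrightarrow> x \<in> layer j \<Longrightarrow> i = j"
proof (induction i arbitrary: x j)
  case 0
  then show ?case using layer_Suc_ge[of x] by (cases j) fastforce+
next
  case (Suc i)
  then obtain y where y: "y \<in> set_decode x" "y \<in> layer i" unfolding mem_layer_Suc_iff by blast
  show ?case
  proof (cases j)
    case 0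
    then show ?thesis using Suc.prems layer_Suc_ge[of x i] by fastforce
  next
    case (Suc k)
    then have "y \<in> layer k" using Suc.prems(2) y(1) unfolding Suc mem_layer_Suc_iff by blast
    then show ?thesis using Suc.IH[OF y(2)] Suc by simp
  qed
qed

text \<open>
  The gadget is asymmetric, and the triangles of the layered graph are those of the gadget, each
  vertex of which lies on one. The two vertices of layer 0 have to be non-adjacent for this.
\<close>

definition gadget :: "(nat \<times> nat) set" where
  "gadget = {(0, 1), (0, 2), (0, 5), (1, 3), (1, 5), (2, 3), (2, 4), (2, 6), (3, 4), (4, 6)}"

definition down_arc :: "nat \<Rightarrow> nat \<Rightarrow> bool" where
  "down_arc y x \<longleftrightarrow> (x, y) \<in> gadget \<or> 7 \<le> y \<and> x \<in> set_decode y"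

definition layered_adj :: "nat \<Rightarrow> nat \<Rightarrow> bool" where
  "layered_adj x y \<longleftrightarrow> down_arc x y \<or> down_arc y x"

definition layered_graph :: "nat set \<Rightarrow> nat pair_pre_digraph" where
  "layered_graph V = \<lparr>pverts = V, parcs = {(x, y). x \<in> V \<and> y \<in> V \<and> layered_adj x y}\<rparr>"

lemma layered_graph_simps [simp]:
  "pverts (layered_graph V) = V"
  "(x, y) \<in> parcs (layered_graph V) \<longleftrightarrow> x \<in> V \<and> y \<in> V \<and> layered_adj x y"
  by (auto simp: layered_graph_def)

lemma down_arc_less: "down_arc y x \<Longrightarrow> x < y"
  by (auto simp: down_arc_def gadget_def dest: set_decode_less)

lemma layered_adj_sym: "layered_adj x y \<longleftrightarrow> layered_adj y x"
  by (auto simp: layered_adj_def)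

lemma layered_adj_of_less: "x < y \<Longrightarrow> layered_adj x y \<longleftrightarrow> down_arc y x"
  by (auto simp: layered_adj_def dest: down_arc_less)

lemma down_arc_ge: "7 \<le> y \<Longrightarrow> down_arc y x \<longleftrightarrow> x \<in> set_decode y"
  by (auto simp: down_arc_def gadget_def)

lemma down_arc_gadget: "y < 7 \<Longrightarrow> down_arc y x \<longleftrightarrow> (x, y) \<in> gadget"
  by (auto simp: down_arc_def gadget_def)

lemma layered_adj_irrefl: "\<not> layered_adj x x"
  using down_arc_less[of x x] by (auto simp: layered_adj_def)

lemma simple_graph_layered: "finite V \<Longrightarrow> V \<noteq> {} \<Longrightarrow> simple_graph (layered_graph V)"
  using layered_adj_irrefl layered_adj_sym by (auto simp: simple_graph_iff irrefl_def sym_def)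

definition stage :: "nat \<Rightarrow> nat set" where
  "stage j = {..<7} \<union> (\<Union>i\<le>j. layer i)"

lemma stage_0: "stage 0 = {..<7}"
  by (auto simp: stage_def)

lemma stage_Suc: "stage (Suc j) = stage j \<union> layer (Suc j)"
  by (auto simp: stage_def atMost_Suc)

lemma finite_stage [simp]: "finite (stage j)"
  by (simp add: stage_def)

lemma stage_ge_imp_layer: "x \<in> stage j \<Longrightarrow> 7 \<le> x \<Longrightarrow> \<exists>i<j. x \<in> layer (Suc i)"
proof (induction j)
  case 0
  then show ?case by (simp add: stage_0)
qed (auto simp: stage_Suc less_Suc_eq)

lemma layer_subset_stage: "i \<le> j \<Longrightarrow> layer i \<subseteq> stage j"
  by (auto simp: stage_def)

lemma layer_independent:
  assumes "x \<in> layer j" "y \<in> layer j" shows "\<not> layered_adj x y"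
proof -
  have less: "\<not> layered_adj u v" if "u < v" "u \<in> layer j" "v \<in> layer j" for u v
  proof (cases j)
    case 0
    then have "u = 5" "v = 6" using that by auto
    then show ?thesis by (simp add: layered_adj_of_less down_arc_def gadget_def)
  next
    case (Suc i)
    then have "set_decode v \<subseteq> layer i" "7 \<le> v"
      using that(3) layer_Suc_ge[of v i] by (auto simp: mem_layer_Suc_iff simp del: layer.simps)
    then show ?thesis
      using that layer_disjoint[of u i j] Suc by (auto simp: layered_adj_of_less down_arc_ge)
  qed
  consider "x < y" | "y < x" | "x = y" by linarith
  then show ?thesis using assms less layered_adj_sym layered_adj_irrefl by cases blast+
qed

lemma layered_triangle_max:
  assumes "layered_adj x y" "layered_adj y z" "layered_adj x z" "x < z" "y < z" "z \<in> stage k"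
  shows "z < 7"
proof (rule ccontr)
  assume "\<not> z < 7"
  then have "7 \<le> z" by simp
  then obtain i where "z \<in> layer (Suc i)" using stage_ge_imp_layer assms(6) by blast
  moreover have "x \<in> set_decode z" "y \<in> set_decode z"
    using assms(2-5) \<open>7 \<le> z\<close> by (simp_all add: layered_adj_of_less down_arc_ge)
  ultimately have "x \<in> layer i" "y \<in> layer i" unfolding mem_layer_Suc_iff by blast+
  then show False using assms(1) layer_independent by blast
qed

lemma layered_triangle:
  assumes "layered_adj x y" "layered_adj y z" "layered_adj x z" "{x, y, z} \<subseteq> stage k"
  shows "x < 7"
proof -
  have "x \<noteq> y" "y \<noteq> z" "x \<noteq> z" using assms(1-3) layered_adj_irrefl by auto
  then consider "x < z" "y < z" | "x < y" "z < y" | "y < x" "z < x" by linarith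
  then show ?thesis
  proof cases
    case 1
    then show ?thesis using layered_triangle_max[of x y z k] assms by simp
  next
    case 2
    then show ?thesis using layered_triangle_max[of x z y k] assms layered_adj_sym by simp
  next
    case 3
    then show ?thesis using layered_triangle_max[of y z x k] assms layered_adj_sym by simp
  qed
qed

lemma layered_adj_gadget:
  assumes "y < 7"
  shows "layered_adj 0 y \<longleftrightarrow> y \<in> {1, 2, 5}" "layered_adj (Suc 0) y \<longleftrightarrow> y \<in> {0, 3, 5}"
    "layered_adj 2 y \<longleftrightarrow> y \<in> {0, 3, 4, 6}" "layered_adj 3 y \<longleftrightarrow> y \<in> {1, 2, 4}"
    "layered_adj 4 y \<longleftrightarrow> y \<in> {2, 3, 6}" "layered_adj 5 y \<longleftrightarrow> y \<in> {0, 1}"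
    "layered_adj 6 y \<longleftrightarrow> y \<in> {2, 4}"
  using assms by (auto simp: layered_adj_def down_arc_gadget) (auto simp: gadget_def)

lemma less_7_iff: "i < 7 \<longleftrightarrow> i \<in> {0, 1, 2, 3, 4, 5, 6 :: nat}"
  by auto

lemma gadget_asymmetric:
  assumes inj: "inj_on f {..<7}" and range: "\<And>i. i < 7 \<Longrightarrow> f i < 7"
    and adj: "\<And>i j. i < 7 \<Longrightarrow> j < 7 \<Longrightarrow> layered_adj i j \<Longrightarrow> layered_adj (f i) (f j)"
    and "w < 7"
  shows "f w = w"
proof -
  note nbrs = layered_adj_gadget[OF range]
  have ne: "f i \<noteq> f j" if "i < 7" "j < 7" "i \<noteq> j" for i j
    using inj that by (auto simp: inj_on_def)
  have edges: "layered_adj (f 2) (f 0)" "layered_adj (f 2) (f 3)" "layered_adj (f 2) (f 4)"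
    "layered_adj (f 2) (f 6)" "layered_adj (f 4) (f 3)" "layered_adj (f 4) (f 6)"
    "layered_adj (f 0) (f 1)" "layered_adj (f 3) (f 1)" "layered_adj (f 0) (f 5)"
    "layered_adj (f 1) (f 5)"
    by (intro adj; simp add: layered_adj_gadget)+
  (* Only 2 has four neighbours, and among these only 4 is adjacent to two others. *)
  have "f 2 = 2"
    using range[of 2] edges(1-4) ne[of 0 3] ne[of 0 4] ne[of 0 6] ne[of 3 4] ne[of 3 6] ne[of 4 6]
    by (auto simp: less_7_iff nbrs)
  then have "f 4 = 4"
    using edges(2-6) ne[of 3 6] ne[of 2 3] ne[of 2 6] by (auto simp: nbrs layered_adj_gadget)
  then have "f 3 \<in> {3, 6}" "f 6 \<in> {3, 6}"
    using edges(5,6) ne[of 2 3] ne[of 2 6] \<open>f 2 = 2\<close> by (auto simp: nbrs layered_adj_gadget)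
  then have "f 0 = 0"
    using edges(1) ne[of 0 3] ne[of 0 6] ne[of 3 6] ne[of 0 4] \<open>f 2 = 2\<close> \<open>f 4 = 4\<close>
    by (auto simp: nbrs layered_adj_gadget)
  then have "f 3 = 3"
    using edges(7,8) \<open>f 3 \<in> {3, 6}\<close> ne[of 1 2] \<open>f 2 = 2\<close> by (auto simp: nbrs layered_adj_gadget)
  then have "f 1 = 1"
    using edges(7,8) \<open>f 0 = 0\<close> ne[of 1 2] \<open>f 2 = 2\<close> by (auto simp: nbrs layered_adj_gadget)
  then have "f 5 = 5"
    using edges(9,10) \<open>f 0 = 0\<close> by (auto simp: nbrs layered_adj_gadget)
  have "f 6 = 6" using \<open>f 6 \<in> {3, 6}\<close> \<open>f 3 = 3\<close> ne[of 3 6] by auto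
  show ?thesis
    using \<open>w < 7\<close> \<open>f 0 = 0\<close> \<open>f 1 = 1\<close> \<open>f 2 = 2\<close> \<open>f 3 = 3\<close> \<open>f 4 = 4\<close> \<open>f 5 = 5\<close> \<open>f 6 = 6\<close>
    by (auto simp: less_7_iff)
qed

lemma gadget_triangles:
  assumes "w < 7"
  obtains x y where "x < 7" "y < 7" "layered_adj w x" "layered_adj x y" "layered_adj w y"
proof -
  consider "w \<in> {0, 1, 5}" | "w \<in> {2, 3, 4}" | "w = 6" using assms by (auto simp: less_7_iff)
  then show thesis
  proof cases
    case 1
    then show ?thesis using that[of 0 1] that[of 0 5] that[of 1 5]
      by (auto simp: layered_adj_gadget)
  next
    case 2
    then show ?thesis using that[of 2 3] that[of 2 4] that[of 3 4]
      by (auto simp: layered_adj_gadget)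
  next
    case 3
    then show ?thesis using that[of 2 4] by (auto simp: layered_adj_gadget)
  qed
qed

lemma identifiable_gadget:
  assumes "{..<7} \<subseteq> V" "V \<subseteq> stage k" "w < 7"
  shows "identifiable (layered_graph V) 7 w"
proof (rule identifiable_rigid)
  fix f assume "embedding 7 (\<lambda>i j. (i, j) \<in> parcs (layered_graph V)) f (layered_graph V)"
  then have f: "f ` {..<7} \<subseteq> V" "inj_on f {..<7}"
    and embed: "i < 7 \<Longrightarrow> j < 7 \<Longrightarrow>
      (f i, f j) \<in> parcs (layered_graph V) \<longleftrightarrow> (i, j) \<in> parcs (layered_graph V)" for i j
    by (simp_all add: embedding_def)
  have adj: "layered_adj (f i) (f j)" if "i < 7" "j < 7" "layered_adj i j" for i j
    using embed[OF that(1,2)] assms(1) that by (simp add: subset_iff)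
  have "f i < 7" if "i < 7" for i
  proof -
    obtain x y where "x < 7" "y < 7" "layered_adj i x" "layered_adj x y" "layered_adj i y"
      using gadget_triangles[OF \<open>i < 7\<close>] by blast
    then show ?thesis
      using f(1) assms(2) that by (intro layered_triangle[of "f i" "f x" "f y" k] adj) auto
  qed
  then show "f w = w" by (rule gadget_asymmetric[OF f(2) _ adj \<open>w < 7\<close>])
qed (use assms in auto)

definition hereditary :: "nat set \<Rightarrow> bool" where
  "hereditary V \<longleftrightarrow> (\<forall>y\<in>V. 7 \<le> y \<longrightarrow> set_decode y \<subseteq> V)"

lemma layered_adj_layer_Suc:
  assumes "v \<in> layer (Suc j)" "x \<in> stage i" "i \<le> j"
  shows "layered_adj v x \<longleftrightarrow> x \<in> set_decode v"
proof -
  have "7 \<le> v" using assms(1) by (rule layer_Suc_ge)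
  moreover have "\<not> down_arc x v"
  proof
    assume "down_arc x v"
    then have "v < x" by (rule down_arc_less)
    then obtain l where "l < i" "x \<in> layer (Suc l)" "7 \<le> x"
      using assms(2) \<open>7 \<le> v\<close> stage_ge_imp_layer[of x i] by auto
    then have "v \<in> layer l"
      using \<open>down_arc x v\<close> by (auto simp: down_arc_ge mem_layer_Suc_iff simp del: layer.simps)
    then show False using layer_disjoint[OF assms(1)] \<open>l < i\<close> assms(3) by fastforce
  qed
  ultimately show ?thesis by (simp add: layered_adj_def down_arc_ge)
qed

lemma layer_Suc_determined:
  assumes V: "hereditary V" "V \<subseteq> stage k"
    and u: "u \<in> V" "u \<in> layer (Suc j)" and v: "v \<in> V" "v \<notin> stage j"
    and adj: "\<And>x. x \<in> V \<inter> stage j \<Longrightarrow> layered_adj v x \<longleftrightarrow> layered_adj u x"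
  shows "v = u"
proof -
  have "7 \<le> v" using v(2) by (auto simp: stage_def)
  then obtain i where i: "v \<in> layer (Suc i)" using stage_ge_imp_layer V(2) v(1) by blast
  have "j \<le> i"
    using i v(2) layer_subset_stage[of "Suc i" j] by (auto simp: not_less_eq_eq[symmetric])
  have sub: "set_decode u \<subseteq> V \<inter> stage j" "set_decode v \<subseteq> V"
    using V(1) u v(1) \<open>7 \<le> v\<close> layer_Suc_ge[OF u(2)] layer_subset_stage[of j j]
    unfolding hereditary_def mem_layer_Suc_iff by blast+
  have decode: "x \<in> set_decode v \<longleftrightarrow> x \<in> set_decode u" if "x \<in> V \<inter> stage j" for x
    using adj[OF that] that layered_adj_layer_Suc[OF u(2)] layered_adj_layer_Suc[OF i _ \<open>j \<le> i\<close>]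
    by auto
  obtain x where "x \<in> set_decode u" "x \<in> layer j" using u(2) unfolding mem_layer_Suc_iff by blast
  then have "x \<in> layer i" using decode sub(1) i unfolding mem_layer_Suc_iff by blast
  then have "i = j" using \<open>x \<in> layer j\<close> by (rule layer_disjoint)
  then have "set_decode v \<subseteq> V \<inter> stage j"
    using i sub(2) layer_subset_stage[of j j] unfolding mem_layer_Suc_iff by blast
  then have "set_decode v = set_decode u" using sub(1) decode by blast
  then show ?thesis by (metis set_decode_inverse)
qed

lemma identifiable_stage:
  assumes V: "{..<7} \<subseteq> V" "V \<subseteq> stage k" "hereditary V" and w: "w \<in> V" "w \<in> stage j"
  shows "identifiable (layered_graph V) (7 + j) w"
  using w
proof (induction j arbitrary: w)
  case 0
  then show ?case using identifiable_gadget[OF V(1,2)] by (simp add: stage_0)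
next
  case (Suc j)
  show ?case
  proof (cases "w \<in> stage j")
    case True
    then show ?thesis using identifiable_Suc[OF Suc.IH] Suc.prems(1) by simp
  next
    case False
    then have "w \<in> layer (Suc j)" using Suc.prems(2) by (simp add: stage_Suc)
    have "identifiable (layered_graph V) (Suc (7 + j)) w"
    proof (rule identifiable_by_adjacency[of "V \<inter> stage j"])
      fix v assume "v \<in> pverts (layered_graph V)" "v \<notin> V \<inter> stage j"
        and "\<And>x. x \<in> V \<inter> stage j \<Longrightarrow>
          (v, x) \<in> parcs (layered_graph V) \<longleftrightarrow> (w, x) \<in> parcs (layered_graph V)"
      then show "v = w"
        using V Suc.prems(1) \<open>w \<in> layer (Suc j)\<close> by (intro layer_Suc_determined[of V k w j v]) auto
    qed (use Suc.IH Suc.prems(1) False in auto)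
    then show ?thesis by simp
  qed
qed

lemma card_layer_Suc: "card (layer (Suc j)) = 2 ^ card (layer j) - 1"
proof -
  have "inj_on set_encode (Pow (layer j) - {{}})"
    by (rule inj_on_subset[OF inj_on_set_encode]) (auto intro: finite_subset[OF _ finite_layer])
  then show ?thesis by (simp add: card_image card_Diff_subset card_Pow)
qed

lemma exists_hereditary:
  assumes "7 \<le> n" "n \<le> card (stage k)"
  shows "\<exists>V. {..<7} \<subseteq> V \<and> V \<subseteq> stage k \<and> hereditary V \<and> card V = n"
  using assms
proof (induction k)
  case 0
  then show ?case by (intro exI[of _ "{..<7}"]) (auto simp: stage_0 hereditary_def)
next
  case (Suc k)
  show ?case
  proof (cases "n \<le> card (stage k)")
    case True
    then show ?thesis using Suc.IH Suc.prems(1) unfolding stage_Suc by blast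
  next
    case False
    then have "\<exists>V. stage k \<subseteq> V \<and> V \<subseteq> stage (Suc k) \<and> card V = n"
      using Suc.prems(2) by (intro exists_subset_between)
        (auto simp: stage_Suc simp del: layer.simps)
    then obtain V where V: "stage k \<subseteq> V" "V \<subseteq> stage (Suc k)" "card V = n" by blast
    have "hereditary V"
      unfolding hereditary_def
    proof (intro ballI impI)
      fix y assume "y \<in> V" "7 \<le> y"
      then obtain i where "i \<le> k" "y \<in> layer (Suc i)"
        using stage_ge_imp_layer[of y "Suc k"] V(2) unfolding less_Suc_eq_le by blast
      then show "set_decode y \<subseteq> V"
        using V(1) layer_subset_stage[of i k] unfolding mem_layer_Suc_iff by blast
    qed
    moreover have "{..<7} \<subseteq> V" using V(1) by (auto simp: stage_def)
    ultimately show ?thesis using V by blast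
  qed
qed

section \<open>Towers and the iterated logarithm\<close>

primrec tower :: "nat \<Rightarrow> nat" where
  "tower 0 = 1"
| "tower (Suc k) = 2 ^ tower k"

lemma less_tower: "k < tower k"
proof (induction k)
  case (Suc k)
  then have "Suc k \<le> tower k" by simp
  also have "tower k < 2 ^ tower k" by (rule less_exp)
  finally show ?case by simp
qed simp

lemma ex_log_iterate_le_1_iff: "(\<exists>j\<le>k. (log 2 ^^ j) x \<le> 1) \<longleftrightarrow> x \<le> real (tower k)"
proof (induction k arbitrary: x)
  case (Suc k)
  have "(\<exists>j\<le>Suc k. (log 2 ^^ j) x \<le> 1) \<longleftrightarrow> x \<le> 1 \<or> (\<exists>j\<le>k. (log 2 ^^ j) (log 2 x) \<le> 1)"
    unfolding less_Suc_eq_le[symmetric] Ex_less_Suc2[of "Suc k"]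
    by (simp add: funpow_Suc_right del: funpow.simps)
  also have "\<dots> \<longleftrightarrow> x \<le> 1 \<or> log 2 x \<le> real (tower k)" by (simp only: Suc.IH)
  also have "\<dots> \<longleftrightarrow> x \<le> real (tower (Suc k))"
    by (cases "x \<le> 1") (auto simp: log_le_iff powr_realpow intro: order_trans[OF _ one_le_power])
  finally show ?case .
qed simp

lemma log_star_le_iff: "log_star x \<le> k \<longleftrightarrow> x \<le> real (tower k)"
proof -
  obtain m :: nat where "x \<le> real m" using real_arch_simple by blast
  then have "x \<le> real (tower m)" using less_tower[of m] by linarith
  then have "\<exists>j. (log 2 ^^ j) x \<le> 1" unfolding ex_log_iterate_le_1_iff[symmetric] by blast
  then have "log_star x \<le> k \<longleftrightarrow> (\<exists>j\<le>k. (log 2 ^^ j) x \<le> 1)"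
    unfolding log_star_def by (metis (mono_tags, lifting) LeastI_ex Least_le le_trans)
  then show ?thesis by (simp add: ex_log_iterate_le_1_iff)
qed

section \<open>The upper bound\<close>

lemma tower_less_card_layer: "tower k < card (layer k)"
proof (induction k)
  case (Suc k)
  have "(1::nat) < 2 ^ tower k" using less_tower[of k] less_exp[of "tower k"] by linarith
  then have "tower (Suc k) < 2 ^ Suc (tower k) - 1" unfolding tower.simps power_Suc by linarith
  also have "\<dots> \<le> card (layer (Suc k))"
    unfolding card_layer_Suc using Suc by (intro diff_le_mono power_increasing) auto
  finally show ?case .
qed simp

lemma q0_le_log_star_if_ge_7:
  assumes "7 \<le> n"
  shows "q0 n \<le> log_star (real n) + 10"
proof -
  define k where "k = log_star (real n)"
  have "n \<le> tower k" using log_star_le_iff[of "real n" k] by (simp add: k_def)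
  also have "\<dots> \<le> card (stage k)"
    using tower_less_card_layer[of k] card_mono[OF finite_stage layer_subset_stage[of k k]] by simp
  finally obtain V where V: "{..<7} \<subseteq> V" "V \<subseteq> stage k" "hereditary V" "card V = n"
    using exists_hereditary[OF assms] by blast
  have simple: "simple_graph (layered_graph V)"
    using V assms by (intro simple_graph_layered finite_subset[OF V(2)]) auto
  moreover have "definable0 (7 + k + 3) (layered_graph V)"
    using V simple by (intro definable0_identifiable identifiable_stage) auto
  ultimately show ?thesis using q0_le[of "layered_graph V" "7 + k + 3"] V(4) by (simp add: k_def)
qed

lemma q0_le_log_star:
  assumes "1 \<le> n"
  shows "q0 n \<le> log_star (real n) + 10"
proof (cases "7 \<le> n")
  case True
  then show ?thesis by (rule q0_le_log_star_if_ge_7)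
next
  case False
  then show ?thesis using q0_le_Suc[OF assms] by linarith
qed

section \<open>Types and witnesses\<close>

datatype tuple_type =
    Atomic "(nat \<times> nat) set" "(nat \<times> nat) set"
  | Extensions "tuple_type fset"

definition positions :: "nat \<Rightarrow> (nat \<times> nat) set" where
  "positions m = (SIGMA j:{..<m}. {..<j})"

primrec type_of :: "nat pair_pre_digraph \<Rightarrow> nat \<Rightarrow> nat list \<Rightarrow> tuple_type" where
  "type_of G 0 xs = Atomic {(j, i) \<in> positions (length xs). xs ! j = xs ! i}
    {(j, i) \<in> positions (length xs). (xs ! j, xs ! i) \<in> parcs G}"
| "type_of G (Suc k) xs = Extensions ((\<lambda>y. type_of G k (xs @ [y])) |`| Abs_fset (pverts G))"

lemma type_of_Suc_eq_iff:
  assumes "finite (pverts G)"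
  shows "type_of G (Suc k) xs = type_of G (Suc k) zs \<longleftrightarrow>
    (\<lambda>y. type_of G k (xs @ [y])) ` pverts G = (\<lambda>y. type_of G k (zs @ [y])) ` pverts G"
  using assms by (simp add: fset_inject[symmetric] Abs_fset_inverse)

lemma type_of_0_eqD:
  assumes "type_of G 0 xs = type_of G 0 zs" "length xs = length zs" "simple_graph G"
    and "i < length xs" "j < length xs"
  shows "(xs ! i = xs ! j \<longleftrightarrow> zs ! i = zs ! j) \<and>
    ((xs ! i, xs ! j) \<in> parcs G \<longleftrightarrow> (zs ! i, zs ! j) \<in> parcs G)"
proof -
  have sym: "sym (parcs G)" and irrefl: "irrefl (parcs G)"
    using assms(3) by (auto simp: simple_graph_iff)
  have less: "(xs ! b = xs ! a \<longleftrightarrow> zs ! b = zs ! a) \<and>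
      ((xs ! b, xs ! a) \<in> parcs G \<longleftrightarrow> (zs ! b, zs ! a) \<in> parcs G)" if "a < b" "b < length xs" for a b
  proof -
    have "(b, a) \<in> positions (length xs)" using that by (simp add: positions_def)
    with assms(1,2) show ?thesis by auto
  qed
  consider "i < j" | "i = j" | "j < i" by linarith
  then show ?thesis
  proof cases
    case 1
    then show ?thesis using less[of i j] assms(5) symD[OF sym] by metis
  next
    case 2
    then show ?thesis using irrefl by (simp add: irrefl_def)
  next
    case 3
    then show ?thesis using less assms(4) by blast
  qed
qed

lemma type_of_eqD:
  assumes "type_of G k xs = type_of G k zs" "length xs = length zs" "simple_graph G"
    and "(x, z) \<in> set (zip xs zs)" "(x', z') \<in> set (zip xs zs)"
  shows "(x = x' \<longleftrightarrow> z = z') \<and> ((x, x') \<in> parcs G \<longleftrightarrow> (z, z') \<in> parcs G)"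
  using assms
proof (induction k arbitrary: xs zs)
  case 0
  then show ?case using type_of_0_eqD[OF 0(1-3)] by (auto simp: set_zip)
next
  case (Suc k)
  then obtain y where "y \<in> pverts G" by (auto simp: simple_graph_iff)
  moreover have "(\<lambda>y. type_of G k (xs @ [y])) ` pverts G = (\<lambda>y. type_of G k (zs @ [y])) ` pverts G"
    using Suc.prems(1,3) type_of_Suc_eq_iff by (simp add: simple_graph_iff del: type_of.simps)
  ultimately obtain u where "type_of G k (xs @ [y]) = type_of G k (zs @ [u])" by blast
  from Suc.IH[OF this] show ?case using Suc.prems by simp
qed

definition representatives :: "('a \<Rightarrow> 'b) \<Rightarrow> 'a set \<Rightarrow> 'a set" where
  "representatives f A = inv_into A f ` f ` A"

lemma representatives_subset: "representatives f A \<subseteq> A"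
  by (auto simp: representatives_def intro: inv_into_into)

lemma exists_representative: "y \<in> A \<Longrightarrow> \<exists>z\<in>representatives f A. f z = f y"
  by (auto simp: representatives_def f_inv_into_f)

lemma card_representatives: "finite A \<Longrightarrow> card (representatives f A) \<le> card (f ` A)"
  by (simp add: representatives_def card_image_le)

primrec witnesses :: "nat pair_pre_digraph \<Rightarrow> nat \<Rightarrow> nat list \<Rightarrow> nat set" where
  "witnesses G 0 xs = {}"
| "witnesses G (Suc k) xs = (\<Union>y\<in>representatives (\<lambda>y. type_of G k (xs @ [y])) (pverts G).
    insert y (witnesses G k (xs @ [y])))"

lemma witnesses_subset: "witnesses G k xs \<subseteq> pverts G"
proof (induction k arbitrary: xs)
  case (Suc k)
  then show ?case
    using representatives_subset[of "\<lambda>y. type_of G k (xs @ [y])" "pverts G"] by auto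
qed simp

lemma exists_witness:
  assumes "type_of G (Suc k) xs = type_of G (Suc k) zs" "finite (pverts G)" "v \<in> pverts G"
  obtains u where "type_of G k (xs @ [u]) = type_of G k (zs @ [v])"
    "insert u (witnesses G k (xs @ [u])) \<subseteq> witnesses G (Suc k) xs"
proof -
  have "type_of G k (zs @ [v]) \<in> (\<lambda>y. type_of G k (xs @ [y])) ` pverts G"
    using assms type_of_Suc_eq_iff by blast
  then obtain y where "y \<in> pverts G" "type_of G k (xs @ [y]) = type_of G k (zs @ [v])" by auto
  then obtain u where "u \<in> representatives (\<lambda>y. type_of G k (xs @ [y])) (pverts G)"
    "type_of G k (xs @ [u]) = type_of G k (zs @ [v])"
    using exists_representative[of y "pverts G" "\<lambda>y. type_of G k (xs @ [y])"] by auto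
  then show thesis by (intro that[of u]) auto
qed

section \<open>Sentences in induced subgraphs\<close>

definition induced :: "nat pair_pre_digraph \<Rightarrow> nat set \<Rightarrow> nat pair_pre_digraph" where
  "induced G W = \<lparr>pverts = W, parcs = parcs G \<inter> W \<times> W\<rparr>"

lemma induced_simps [simp]:
  "pverts (induced G W) = W"
  "parcs (induced G W) = parcs G \<inter> W \<times> W"
  by (auto simp: induced_def)

lemma simple_graph_induced:
  "simple_graph G \<Longrightarrow> W \<subseteq> pverts G \<Longrightarrow> W \<noteq> {} \<Longrightarrow> simple_graph (induced G W)"
  by (auto simp: simple_graph_iff sym_def irrefl_def finite_subset)

lemma existential_induced_upward:
  assumes "existential \<phi>" "W \<subseteq> pverts G" "\<And>x. x \<in> free_vars \<phi> \<Longrightarrow> e x \<in> W"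
    and "sat (induced G W) e \<phi>"
  shows "sat G e \<phi>"
  using assms
proof (induction \<phi> arbitrary: e)
  case (ExQ x \<phi>)
  then obtain v where v: "v \<in> W" "sat (induced G W) (e(x := v)) \<phi>" by auto
  have "sat G (e(x := v)) \<phi>"
    by (rule ExQ.IH[OF _ ExQ.prems(2) _ v(2)]) (use ExQ.prems v(1) in auto)
  then show ?case using ExQ.prems(2) v(1) by auto
qed auto

lemma sat_induced_atom_iff:
  assumes "simple_graph G" "set xs \<subseteq> W" "length xs = length zs" "type_of G k xs = type_of G k zs"
    and vars: "\<And>v. v = x \<or> v = y \<Longrightarrow> (e' v, e v) \<in> set (zip xs zs)"
  shows "sat (induced G W) e' (Eq x y) \<longleftrightarrow> sat G e (Eq x y)"
    and "sat (induced G W) e' (Adj x y) \<longleftrightarrow> sat G e (Adj x y)"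
proof -
  have "e' x \<in> W" "e' y \<in> W" using assms(2) set_zip_leftD[OF vars] by auto
  then show "sat (induced G W) e' (Eq x y) \<longleftrightarrow> sat G e (Eq x y)"
    "sat (induced G W) e' (Adj x y) \<longleftrightarrow> sat G e (Adj x y)"
    using type_of_eqD[OF assms(4,3,1) vars[of x] vars[of y]] by simp_all
qed

lemma existential_induced_downward:
  assumes "existential \<phi>" "quantifier_depth \<phi> \<le> k" and G: "simple_graph G"
    and "set xs \<subseteq> W" "witnesses G k xs \<subseteq> W"
    and "length xs = length zs" "type_of G k xs = type_of G k zs"
    and "\<And>x. x \<in> free_vars \<phi> \<Longrightarrow> (e' x, e x) \<in> set (zip xs zs)"
    and "sat G e \<phi>"
  shows "sat (induced G W) e' \<phi>"
  using assms(1,2,4-)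
proof (induction \<phi> arbitrary: k xs zs e e')
  case (Eq x y)
  then show ?case using sat_induced_atom_iff(1)[OF G Eq.prems(3,5,6), of x y e' e] by simp
next
  case (Adj x y)
  then show ?case using sat_induced_atom_iff(2)[OF G Adj.prems(3,5,6), of x y e' e] by simp
next
  case (Neg \<phi>)
  then obtain x y where "\<phi> = Eq x y \<or> \<phi> = Adj x y" by auto
  then show ?case
    using Neg.prems(7,8) sat_induced_atom_iff[OF G Neg.prems(3,5,6), of x y e' e] by auto
next
  case (Conj \<phi> \<psi>)
  then show ?case
    using Conj.IH(1)[OF _ _ Conj.prems(3-6), of e' e] Conj.IH(2)[OF _ _ Conj.prems(3-6), of e' e]
    by simp
next
  case (Disj \<phi> \<psi>)
  then show ?case
    using Disj.IH(1)[OF _ _ Disj.prems(3-6), of e' e] Disj.IH(2)[OF _ _ Disj.prems(3-6), of e' e]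
    by auto
next
  case (ExQ x \<phi>)
  obtain v where v: "v \<in> pverts G" "sat G (e(x := v)) \<phi>" using ExQ.prems(8) by auto
  obtain l where k: "k = Suc l" "quantifier_depth \<phi> \<le> l" using ExQ.prems(2) by (cases k) auto
  have "finite (pverts G)" using G by (simp add: simple_graph_iff)
  then obtain u where u: "type_of G l (xs @ [u]) = type_of G l (zs @ [v])"
    "insert u (witnesses G l (xs @ [u])) \<subseteq> witnesses G k xs"
    using exists_witness[of G l xs zs v] ExQ.prems(6) v(1) unfolding k(1) by blast
  then have u_in_W: "insert u (witnesses G l (xs @ [u])) \<subseteq> W" using ExQ.prems(4) by blast
  have "sat (induced G W) (e'(x := u)) \<phi>"
  proof (rule ExQ.IH[OF _ k(2) _ _ _ u(1) _ v(2)])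
    show "((e'(x := u)) y, (e(x := v)) y) \<in> set (zip (xs @ [u]) (zs @ [v]))"
      if "y \<in> free_vars \<phi>" for y
      using that ExQ.prems(5,7) by auto
  qed (use u_in_W ExQ.prems in auto)
  then show ?case using u_in_W by auto
qed auto

lemma zero_alternating_induced:
  assumes "sentence \<phi>" "zero_alternating \<phi>" "quantifier_depth \<phi> \<le> d" "simple_graph G" "sat G e \<phi>"
  shows "sat (induced G (witnesses G d [])) e \<phi>"
  using assms(1-3,5)
proof (induction \<phi>)
  case (ExQ x \<phi>)
  then have "existential (ExQ x \<phi>)" by simp
  then show ?case
    by (rule existential_induced_downward[where k = d and xs = "[]" and zs = "[]" and e = e])
      (use ExQ.prems assms(4) in \<open>auto simp: sentence_def\<close>)
next
  case (AllQ x \<phi>)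
  have "\<not> sat (induced G (witnesses G d [])) e (dual (AllQ x \<phi>))"
  proof
    assume dual_induced: "sat (induced G (witnesses G d [])) e (dual (AllQ x \<phi>))"
    have "sat G e (dual (AllQ x \<phi>))"
      by (rule existential_induced_upward[OF _ witnesses_subset _ dual_induced])
        (use AllQ.prems in \<open>auto simp: sentence_def intro: only_quantifier_dual[of Forall]\<close>)
    then show False using AllQ.prems(4) by simp
  qed
  then show ?case by simp
qed (auto simp: sentence_def zero_alternating_def)

section \<open>The lower bound\<close>

definition types :: "nat pair_pre_digraph \<Rightarrow> nat \<Rightarrow> nat \<Rightarrow> tuple_type set" where
  "types G d k = type_of G k ` {xs. length xs + k = d}"

text \<open>One bit for equality and one for adjacency at each of the \<open>d (d - 1) / 2\<close> pairs of positions.\<close>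

primrec type_bound :: "nat \<Rightarrow> nat \<Rightarrow> nat" where
  "type_bound d 0 = 2 ^ (d * (d - 1))"
| "type_bound d (Suc k) = 2 ^ type_bound d k"

lemma finite_positions [simp]: "finite (positions m)"
  by (simp add: positions_def)

lemma card_positions: "card (positions m) = m * (m - 1) div 2"
  unfolding positions_def by (simp add: Sum_Ico_nat flip: atLeast0LessThan)

lemma types_0_subset:
  "types G d 0 \<subseteq> (\<lambda>(E, A). Atomic E A) ` (Pow (positions d) \<times> Pow (positions d))"
  by (auto simp: types_def)

lemma types_Suc_subset:
  assumes "finite (pverts G)"
  shows "types G d (Suc k) \<subseteq> (Extensions \<circ> Abs_fset) ` Pow (types G d k)"
proof
  fix c assume "c \<in> types G d (Suc k)"
  then obtain xs where xs: "length xs + Suc k = d" "c = type_of G (Suc k) xs"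
    by (auto simp: types_def)
  let ?F = "(\<lambda>y. type_of G k (xs @ [y])) ` pverts G"
  have "?F \<subseteq> types G d k" using xs(1) by (auto simp: types_def)
  moreover have "c = Extensions (Abs_fset ?F)"
    using assms xs(2) by (simp add: fset_inject[symmetric] Abs_fset_inverse)
  ultimately show "c \<in> (Extensions \<circ> Abs_fset) ` Pow (types G d k)" by auto
qed

lemma finite_types: "finite (pverts G) \<Longrightarrow> finite (types G d k)"
proof (induction k)
  case 0
  then show ?case using finite_subset[OF types_0_subset] by simp
next
  case (Suc k)
  then show ?case using finite_subset[OF types_Suc_subset] by simp
qed

lemma card_types_le:
  assumes "finite (pverts G)"
  shows "card (types G d k) \<le> type_bound d k"
proof (induction k)
  case 0
  have "card (types G d 0) \<le> card (Pow (positions d) \<times> Pow (positions d))"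
    by (rule surj_card_le[OF _ types_0_subset]) simp
  also have "\<dots> = 2 ^ (2 * card (positions d))"
    by (simp add: card_cartesian_product card_Pow power_add[symmetric] mult_2)
  also have "2 * card (positions d) = d * (d - 1)"
    unfolding card_positions by (cases d) simp_all
  finally show ?case by simp
next
  case (Suc k)
  have "card (types G d (Suc k)) \<le> card (Pow (types G d k))"
    using assms by (intro surj_card_le[OF _ types_Suc_subset]) (simp_all add: finite_types)
  also have "\<dots> \<le> type_bound d (Suc k)" using assms Suc by (simp add: card_Pow finite_types)
  finally show ?case .
qed

lemma card_witnesses_Suc_le:
  assumes fin: "finite (pverts G)" and d: "length xs + Suc k = d"
    and m: "\<And>y. Suc (card (witnesses G k (xs @ [y]))) \<le> m"
  shows "card (witnesses G (Suc k) xs) \<le> type_bound d k * m"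
proof -
  let ?f = "\<lambda>y. type_of G k (xs @ [y])"
  let ?Y = "representatives ?f (pverts G)"
  have "finite ?Y" using fin representatives_subset by (rule finite_subset[rotated])
  have "?f ` pverts G \<subseteq> types G d k" using d by (auto simp: types_def)
  then have Y: "card ?Y \<le> type_bound d k"
    using card_representatives[OF fin] card_types_le[OF fin] finite_types[OF fin]
    by (meson card_mono le_trans)
  have "card (witnesses G (Suc k) xs) \<le> (\<Sum>y\<in>?Y. card (insert y (witnesses G k (xs @ [y]))))"
    unfolding witnesses.simps by (rule card_UN_le) fact
  also have "\<dots> \<le> (\<Sum>y\<in>?Y. m)"
  proof (rule sum_mono)
    show "card (insert y (witnesses G k (xs @ [y]))) \<le> m" for y
      using m[of y] by (intro card_insert_le_m1) auto
  qed
  also have "\<dots> \<le> type_bound d k * m" using Y by simp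
  finally show ?thesis .
qed

lemma power2_le_two_power: "4 \<le> n \<Longrightarrow> n ^ 2 \<le> (2::nat) ^ n"
proof (induction n rule: nat_induct_at_least)
  case (Suc n)
  have "4 * n \<le> n ^ 2" using Suc.hyps by (simp add: power2_eq_square)
  then have "Suc n ^ 2 \<le> 2 * n ^ 2"
    using Suc.hyps unfolding Suc_eq_plus1 power2_sum one_power2 mult_1_right by linarith
  then show ?case using Suc.IH by simp
qed simp

lemma power3_less_two_power_power2: "n ^ 3 < ((2::nat) ^ n) ^ 2"
proof (cases "4 \<le> n")
  case True
  have "n ^ 3 < n ^ 4" using True by (intro power_strict_increasing) auto
  also have "\<dots> = (n ^ 2) ^ 2" by (simp flip: power_mult)
  also have "\<dots> \<le> (2 ^ n) ^ 2" using power2_le_two_power[OF True] by (rule power_mono) simp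
  finally show ?thesis .
next
  case False
  then have "n \<in> {0, 1, 2, 3}" by auto
  then show ?thesis by auto
qed

lemma Suc_card_witnesses_le:
  assumes "finite (pverts G)"
  shows "length xs + k = d \<Longrightarrow> Suc (card (witnesses G k xs)) \<le> type_bound d k ^ 2"
proof (induction k arbitrary: xs)
  case (Suc k)
  have "card (witnesses G (Suc k) xs) \<le> type_bound d k * type_bound d k ^ 2"
    using Suc by (intro card_witnesses_Suc_le[OF assms]) auto
  also have "\<dots> = type_bound d k ^ 3" by (simp add: power3_eq_cube power2_eq_square)
  also have "\<dots> < type_bound d (Suc k) ^ 2"
    using power3_less_two_power_power2[of "type_bound d k"] by simp
  finally show ?case by (rule Suc_leI)
qed simp

lemma mult_pred_add_2_le_two_power: "1 \<le> d \<Longrightarrow> d * (d - 1) + 2 \<le> 2 ^ d"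
proof (induction d rule: nat_induct_at_least)
  case (Suc d)
  have "d \<le> 2 ^ (d - 1)" using Suc.hyps less_exp[of "d - 1"] by linarith
  then have "2 * d \<le> 2 ^ d" using Suc.hyps by (cases d) auto
  moreover have "Suc d * (Suc d - 1) = d * (d - 1) + 2 * d"
    using Suc.hyps by (cases d) auto
  ultimately show ?case using Suc.IH by simp
qed simp

lemma type_bound_pos: "0 < type_bound d k"
  by (cases k) auto

lemma type_bound_le_tower:
  assumes "1 \<le> d" "d \<le> tower r"
  shows "3 * type_bound d k \<le> tower (Suc (Suc r) + k)"
proof (induction k)
  case 0
  have "3 * type_bound d 0 \<le> 2 ^ (d * (d - 1) + 2)" by (simp add: power_add)
  also have "\<dots> \<le> 2 ^ 2 ^ d"
    using mult_pred_add_2_le_two_power[OF assms(1)] by (intro power_increasing) auto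
  also have "\<dots> \<le> 2 ^ 2 ^ tower r" using assms(2) by (intro power_increasing) auto
  finally show ?case by simp
next
  case (Suc k)
  have "3 * type_bound d (Suc k) \<le> 2 ^ (type_bound d k + 2)" by (simp add: power_add)
  also have "\<dots> \<le> 2 ^ tower (Suc (Suc r) + k)"
    using Suc type_bound_pos[of d k] by (intro power_increasing) auto
  finally show ?case by simp
qed

lemma card_witnesses_le_tower:
  assumes "finite (pverts G)" "1 \<le> d" "d \<le> tower r"
  shows "card (witnesses G d []) \<le> tower (Suc r + d)"
proof -
  obtain k where d: "d = Suc k" using assms(2) by (cases d) auto
  have "card (witnesses G d []) \<le> type_bound d k * type_bound d k ^ 2"
    unfolding d using assms(1) by (intro card_witnesses_Suc_le Suc_card_witnesses_le) auto
  also have "\<dots> = type_bound d k ^ 3" by (simp add: power3_eq_cube power2_eq_square)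
  also have "\<dots> \<le> tower (Suc r + d)"
  proof (cases k)
    case 0
    then show ?thesis using less_tower[of "Suc r + d"] by (simp add: d)
  next
    case (Suc l)
    have "type_bound d k ^ 3 = 2 ^ (3 * type_bound d l)"
      by (simp add: Suc power_mult[symmetric] mult.commute)
    also have "\<dots> \<le> 2 ^ tower (Suc (Suc r) + l)"
      using type_bound_le_tower[OF assms(2,3)] by (intro power_increasing) auto
    finally show ?thesis by (simp add: d Suc)
  qed
  finally show ?thesis .
qed

lemma quantifier_depth_sentence: "sentence \<phi> \<Longrightarrow> 1 \<le> quantifier_depth \<phi>"
  by (induction \<phi>) (auto simp: sentence_def)

lemma card_le_tower:
  assumes G: "simple_graph G" and "definable0 d G" "d \<le> tower r"
  shows "card (pverts G) \<le> tower (Suc r + d)"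
proof -
  obtain \<phi> where \<phi>: "sentence \<phi>" "zero_alternating \<phi>" "defines_graph \<phi> G" "quantifier_depth \<phi> \<le> d"
    using assms(2) by (auto simp: definable0_def)
  have d: "1 \<le> d" using quantifier_depth_sentence[OF \<phi>(1)] \<phi>(4) by simp
  define W where "W = witnesses G d []"
  have fin: "finite (pverts G)" and ne: "pverts G \<noteq> {}" using G by (auto simp: simple_graph_iff)
  have "W \<noteq> {}" using d ne by (cases d) (auto simp: W_def representatives_def)
  then have simple: "simple_graph (induced G W)"
    using G witnesses_subset by (intro simple_graph_induced) (auto simp: W_def)
  have "sat G undefined \<phi>" using \<phi>(1,3) models_iff_sat[OF _ ne] by (simp add: defines_graph_def)
  then have "sat (induced G W) undefined \<phi>"
    unfolding W_def using zero_alternating_induced \<phi> G by blast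
  then have "models (induced G W) \<phi>"
    using models_iff_sat[OF \<phi>(1), of "induced G W" undefined] \<open>W \<noteq> {}\<close> by simp
  then have "digraph_iso (with_proj (induced G W)) (with_proj G)"
    using \<phi>(3) simple by (auto simp: defines_graph_def)
  then have "card (pverts G) = card W" using card_pverts_digraph_iso by fastforce
  also have "\<dots> \<le> tower (Suc r + d)"
    unfolding W_def by (rule card_witnesses_le_tower[OF fin d assms(3)])
  finally show ?thesis .
qed

lemma log_star_le_q0:
  assumes "1 \<le> n"
  shows "log_star (real n) \<le> q0 n + log_star (real (log_star (real n))) + 1"
proof (cases "q0 n \<le> log_star (real n)")
  case True
  obtain G where G: "simple_graph G" "card (pverts G) = n" "definable0 (q0 n) G"
    by (rule q0_attained[OF assms])
  define r where "r = log_star (real (log_star (real n)))"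
  have "log_star (real n) \<le> tower r"
    using log_star_le_iff[of "real (log_star (real n))" r] by (simp add: r_def)
  then have "n \<le> tower (Suc r + q0 n)" using card_le_tower[OF G(1,3)] G(2) True by simp
  then have "log_star (real n) \<le> Suc r + q0 n" unfolding log_star_le_iff by simp
  then show ?thesis by (simp add: r_def)
qed simp

theorem theorem1:
  fixes n :: nat
  assumes "n \<ge> 1"
  shows "int (log_star (real n)) - int (log_star (real (log_star (real n)))) - 1 \<le> int (q0 n)
    \<and> int (q0 n) \<le> int (log_star (real n)) + 22"
  using log_star_le_q0[OF assms] q0_le_log_star[OF assms] by linarith

end
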